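(* Let $(T,G_x)$ be a graph-labelled-tree factorisation of a connected graph $G$ (i.e. a graph-labelled-tree with accessibility graph $G$), each factor $G_x$ being equipped with the weights given by numbers of immediately accessible leaves. Then: (1) $G$ satisfies (EN1) if and only if all the $\mathbb{Z}$-weighted factors $G_x$ satisfy the weighted condition (EN1). (2) $G$ satisfies (EN2) if and only if all the $\mathbb{Z}/2$-weighted factors $G_x$ satisfy the weighted condition (EN2). (3) $G$ satisfies (RC) if and only if all the $\mathbb{Z}/2$-weighted factors $G_x$ satisfy the weighted condition (RC). Consequently, if all vertices of $G$ have even degree, then $G$ is Gaussian if and only if all the factors $G_x$ are CL2.
   Context: Graphs are finite and simple, with adjacency matrix $\mathfrak{e}$; $N(x)$ is the set of neighbours of $x$. For an unweighted graph $G$ let $\mathfrak{r}=\mathfrak{e}+\mathfrak{e}^2$. Conditions: (EN1) every vertex has even degree; (EN2) any two distinct non-adjacent vertices have an even number of common neighbours; (RC) the sum of $\mathfrak{r}$ over the edges of every closed walk in $G$ vanishes modulo $2$. $G$ is Gaussian when it satisfies (EN1), (EN2) and (RC). A graph-labelled-tree is a tree $T$ with graphs $G_x$ indexed by its nodes (vertices of degree $>1$; the vertices of degree $1$ are leaves) and bijections $\rho_x$ from the vertices of $G_x$ to the neighbours of $x$ in $T$. Its accessibility graph has vertices the leaves of $T$; distinct leaves $u,v$ are adjacent when for each node $x_i$ of the injective path $u=x_0,x_1,\dots,x_l,x_{l+1}=v$ in $T$, the vertices of $G_{x_i}$ mapped by $\rho_{x_i}$ to $x_{i-1}$ and $x_{i+1}$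 are adjacent. Weights: a leaf $v$ of $T$ is immediately accessible from a vertex $u$ of the factor $G_{x_0}$ when the injective path $x_0,x_1,\dots,x_l,x_{l+1}=v$ in $T$ satisfies $x_1=\rho_{x_0}(u)$ and, for every $1\le i\le l$, the vertices of $G_{x_i}$ mapped by $\rho_{x_i}$ to $x_{i-1}$ and $x_{i+1}$ are adjacent. The weight $\mathfrak{w}(u)$ is the number of leaves immediately accessible from $u$ (so $\mathfrak{w}(u)=1$ if $\rho_{x_0}(u)$ is a leaf). For a set $U$ of vertices of a factor put $\mathfrak{w}(U)=\sum_{u\in U}\mathfrak{w}(u)$. Weighted conditions for a weighted graph $(\mathfrak{e},\mathfrak{w})$, with $\mathfrak{r}(x,y)=\mathfrak{e}(x,y)+\mathfrak{w}(N(x)\cap N(y))$: weighted (EN1): for every vertex $x$, if $\mathfrak{w}(x)=1$ in $\mathbb{Z}$ then $\mathfrak{w}(N(x))\equiv0\pmod 2$; weighted (EN2): for all distinct non-adjacent $x,y$, $\mathfrak{r}(x,y)\equiv 0\pmod 2$; weighted (RC): the sum of $\mathfrak{r}$ over the edges of every closed walk is $\equiv0\pmod 2$. A weighted graph is CL2 when it satisfies the $\mathbb{Z}/2$-weighted conditions (EN2) and (RC).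
   Formalization: Part (1) is stated only for trees T with at least one node: if T is a single edge, then G is a single edge with odd degrees, while the condition on the factors holds vacuously, so (1) fails there. *)

theory Defs
  imports "Graph_Theory.Graph_Theory" "HOL-Number_Theory.Cong"
begin

text \<open>
  A finite simple graph is a symmetric loop-free digraph whose arcs are pairs of vertices, i.e. an
  instance of the locale \<^locale>\<open>pair_graph\<close>.  Walks are lists of vertices (\<^const>\<open>vwalk\<close>), and
  injective paths are walks without repeated vertices (\<^const>\<open>vpath\<close>).
\<close>

definition neighbours :: "'a pair_pre_digraph \<Rightarrow> 'a \<Rightarrow> 'a set" where
  "neighbours G x = {y. (x, y) \<in> parcs G}"

definition degree :: "'a pair_pre_digraph \<Rightarrow> 'a \<Rightarrow> nat" where
  "degree G x = card (neighbours G x)"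

definition adj_mat :: "'a pair_pre_digraph \<Rightarrow> 'a \<Rightarrow> 'a \<Rightarrow> int" where
  "adj_mat G x y = of_bool ((x, y) \<in> parcs G)"

definition closed_vwalk :: "'a pair_pre_digraph \<Rightarrow> 'a list \<Rightarrow> bool" where
  "closed_vwalk G p \<longleftrightarrow> vwalk p (with_proj G) \<and> hd p = last p"

definition walk_sum :: "('a \<Rightarrow> 'a \<Rightarrow> int) \<Rightarrow> 'a list \<Rightarrow> int" where
  "walk_sum f p = (\<Sum>(x, y)\<leftarrow>vwalk_arcs p. f x y)"


section \<open>Gaussian graphs\<close>

text \<open>This is the entry at \<open>(x, y)\<close> of \<open>e + e\<^sup>2\<close>, where \<open>e\<close> is the adjacency matrix.\<close>

definition r_mat :: "'a pair_pre_digraph \<Rightarrow> 'a \<Rightarrow> 'a \<Rightarrow> int" where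
  "r_mat G x y = adj_mat G x y + (\<Sum>z\<in>pverts G. adj_mat G x z * adj_mat G z y)"

definition EN1 :: "'a pair_pre_digraph \<Rightarrow> bool" where
  "EN1 G \<longleftrightarrow> (\<forall>x\<in>pverts G. even (degree G x))"

definition EN2 :: "'a pair_pre_digraph \<Rightarrow> bool" where
  "EN2 G \<longleftrightarrow> (\<forall>x\<in>pverts G. \<forall>y\<in>pverts G. x \<noteq> y \<and> (x, y) \<notin> parcs G \<longrightarrow>
     even (card (neighbours G x \<inter> neighbours G y)))"

definition RC :: "'a pair_pre_digraph \<Rightarrow> bool" where
  "RC G \<longleftrightarrow> (\<forall>p. closed_vwalk G p \<longrightarrow> [walk_sum (r_mat G) p = 0] (mod 2))"

definition Gaussian :: "'a pair_pre_digraph \<Rightarrow> bool" where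
  "Gaussian G \<longleftrightarrow> EN1 G \<and> EN2 G \<and> RC G"


section \<open>Weighted graphs\<close>

text \<open>
  A weighted graph is a graph together with an integer weight function on its vertices.
  The conditions \<open>wEN2\<close> and \<open>wRC\<close> are congruences modulo 2 that depend only on the residues of the
  weights, so imposing them on integer weights is the same as imposing them on the induced weights
  in \<open>\<int>/2\<close>.  In contrast, \<open>wEN1\<close> tests \<open>w x = 1\<close> in the integers.
\<close>

definition wr_mat :: "'a pair_pre_digraph \<Rightarrow> ('a \<Rightarrow> int) \<Rightarrow> 'a \<Rightarrow> 'a \<Rightarrow> int" where
  "wr_mat G w x y = adj_mat G x y + sum w (neighbours G x \<inter> neighbours G y)"

definition wEN1 :: "'a pair_pre_digraph \<Rightarrow> ('a \<Rightarrow> int) \<Rightarrow> bool" where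
  "wEN1 G w \<longleftrightarrow> (\<forall>x\<in>pverts G. w x = 1 \<longrightarrow> [sum w (neighbours G x) = 0] (mod 2))"

definition wEN2 :: "'a pair_pre_digraph \<Rightarrow> ('a \<Rightarrow> int) \<Rightarrow> bool" where
  "wEN2 G w \<longleftrightarrow> (\<forall>x\<in>pverts G. \<forall>y\<in>pverts G. x \<noteq> y \<and> (x, y) \<notin> parcs G \<longrightarrow>
     [wr_mat G w x y = 0] (mod 2))"

definition wRC :: "'a pair_pre_digraph \<Rightarrow> ('a \<Rightarrow> int) \<Rightarrow> bool" where
  "wRC G w \<longleftrightarrow> (\<forall>p. closed_vwalk G p \<longrightarrow> [walk_sum (wr_mat G w) p = 0] (mod 2))"

definition CL2 :: "'a pair_pre_digraph \<Rightarrow> ('a \<Rightarrow> int) \<Rightarrow> bool" where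
  "CL2 G w \<longleftrightarrow> wEN2 G w \<and> wRC G w"


section \<open>Graph-labelled trees\<close>

text \<open>
  The constant \<^const>\<open>tree\<close> is unsuitable for symmetric digraphs: there every edge, traversed
  back and forth, counts as a \<^const>\<open>pre_digraph.cycle\<close>.  Cycles of an undirected graph are those
  of length at least 3.
\<close>

definition undirected_tree :: "'n pair_pre_digraph \<Rightarrow> bool" where
  "undirected_tree T \<longleftrightarrow> pair_graph T \<and> connected (with_proj T) \<and>
     \<not> (\<exists>c. pre_digraph.cycle (with_proj T) c \<and> 3 \<le> length c)"

definition nodes :: "'n pair_pre_digraph \<Rightarrow> 'n set" where
  "nodes T = {x \<in> pverts T. 1 < degree T x}"

definition leaves :: "'n pair_pre_digraph \<Rightarrow> 'n set" where
  "leaves T = {x \<in> pverts T. degree T x = 1}"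

text \<open>
  Only the values of \<open>F\<close> and \<open>\<rho>\<close> at nodes of \<open>T\<close> matter.  Using one type \<open>'v\<close> for the vertices of
  all factors is no restriction, and the vertex sets of different factors may overlap.
\<close>

locale graph_labelled_tree =
  fixes T :: "'n pair_pre_digraph"
    and F :: "'n \<Rightarrow> 'v pair_pre_digraph"
    and \<rho> :: "'n \<Rightarrow> 'v \<Rightarrow> 'n"
  assumes tree: "undirected_tree T"
    and factor: "x \<in> nodes T \<Longrightarrow> pair_graph (F x)"
    and bij: "x \<in> nodes T \<Longrightarrow> bij_betw (\<rho> x) (pverts (F x)) (neighbours T x)"

definition factor_adj ::
    "('n \<Rightarrow> 'v pair_pre_digraph) \<Rightarrow> ('n \<Rightarrow> 'v \<Rightarrow> 'n) \<Rightarrow> 'n \<Rightarrow> 'n \<Rightarrow> 'n \<Rightarrow> bool" where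
  "factor_adj F \<rho> x y z \<longleftrightarrow> (\<exists>(u, v)\<in>parcs (F x). \<rho> x u = y \<and> \<rho> x v = z)"

text \<open>
  The interior vertices of an injective path in a tree have degree at least 2, hence are nodes.
\<close>

definition accessible_along ::
    "('n \<Rightarrow> 'v pair_pre_digraph) \<Rightarrow> ('n \<Rightarrow> 'v \<Rightarrow> 'n) \<Rightarrow> 'n list \<Rightarrow> bool" where
  "accessible_along F \<rho> p \<longleftrightarrow>
     (\<forall>i. 0 < i \<and> i + 1 < length p \<longrightarrow> factor_adj F \<rho> (p ! i) (p ! (i - 1)) (p ! (i + 1)))"

definition accessibility_graph ::
    "'n pair_pre_digraph \<Rightarrow> ('n \<Rightarrow> 'v pair_pre_digraph) \<Rightarrow> ('n \<Rightarrow> 'v \<Rightarrow> 'n)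
     \<Rightarrow> 'n pair_pre_digraph" where
  "accessibility_graph T F \<rho> =
     \<lparr> pverts = leaves T,
       parcs = {(u, v). u \<in> leaves T \<and> v \<in> leaves T \<and> u \<noteq> v \<and>
         (\<exists>p. vpath p (with_proj T) \<and> hd p = u \<and> last p = v \<and> accessible_along F \<rho> p)} \<rparr>"

definition immediately_accessible ::
    "'n pair_pre_digraph \<Rightarrow> ('n \<Rightarrow> 'v pair_pre_digraph) \<Rightarrow> ('n \<Rightarrow> 'v \<Rightarrow> 'n)
     \<Rightarrow> 'n \<Rightarrow> 'v \<Rightarrow> 'n set" where
  "immediately_accessible T F \<rho> x u =
     {v \<in> leaves T. \<exists>q. vpath (x # \<rho> x u # q) (with_proj T) \<and> last (x # \<rho> x u # q) = v \<and>
        accessible_along F \<rho> (x # \<rho> x u # q)}"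

definition weight ::
    "'n pair_pre_digraph \<Rightarrow> ('n \<Rightarrow> 'v pair_pre_digraph) \<Rightarrow> ('n \<Rightarrow> 'v \<Rightarrow> 'n)
     \<Rightarrow> 'n \<Rightarrow> 'v \<Rightarrow> int" where
  "weight T F \<rho> x u = int (card (immediately_accessible T F \<rho> x u))"

end

theory Submission
  imports Defs
begin

text \<open>
  Every edge \<open>xy\<close> of the tree splits the leaves into two branches, and a leaf on one side is adjacent
  to a leaf on the other iff both are accessible through \<open>xy\<close>.  Connectedness of \<open>G\<close> therefore makes
  all weights positive, so every vertex of a factor is represented by an accessible leaf.

  For (EN1), summing the degrees over one branch shows that the number of crossing edges, a product of
  two opposite weights, is even; conversely a leaf has weight 1 in the factor next to it.

  For (EN2) and (RC), let \<open>u\<close> and \<open>v\<close> be leaves.  A common neighbour of \<open>u\<close> and \<open>v\<close> leaves the path from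
  \<open>u\<close> to \<open>v\<close> at some node \<open>x\<close>, and the path has to be accessible at all other nodes.  So the number of
  common neighbours is a sum of local terms \<open>w (N a \<inter> N b)\<close> over the path if \<open>u\<close> and \<open>v\<close> are adjacent, a
  single such term if accessibility fails at exactly one node, and 0 otherwise.

  (RC) says that \<open>r\<close> is modulo 2 a coboundary \<open>\<phi> x + \<phi> y\<close> on the edges.  As the local terms are additive
  along paths, potentials on the factors and a potential on \<open>G\<close> can be computed from each other.
\<close>

section \<open>Consecutive triples in lists\<close>

text \<open>This form is used twice below. With factor adjacency at the middle entry it expresses
  accessibility along a list, and with inequality of the outer entries it expresses the absence of
  immediate returns in a walk.\<close>

fun all_triples :: "('a \<Rightarrow> 'a \<Rightarrow> 'a \<Rightarrow> bool) \<Rightarrow> 'a list \<Rightarrow> bool" where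
  "all_triples P (x # y # z # r) \<longleftrightarrow> P x y z \<and> all_triples P (y # z # r)"
| "all_triples P _ \<longleftrightarrow> True"

fun sum_triples :: "('a \<Rightarrow> 'a \<Rightarrow> 'a \<Rightarrow> int) \<Rightarrow> 'a list \<Rightarrow> int" where
  "sum_triples f (x # y # z # r) = f x y z + sum_triples f (y # z # r)"
| "sum_triples f _ = 0"

text \<open>If two lists overlap in two entries, every consecutive triple of their union lies in one
  of them. This is why paths are cut and glued at an edge and not at a vertex.\<close>

lemma all_triples_glue: "all_triples P (p @ x # y # q) \<longleftrightarrow> all_triples P (p @ [x, y]) \<and> all_triples P (x # y # q)"
proof (induction p)
  case (Cons a p)
  then show ?case by (cases p; cases "tl p") auto
qed simp

lemma sum_triples_glue: "sum_triples f (p @ x # y # q) = sum_triples f (p @ [x, y]) + sum_triples f (x # y # q)"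
proof (induction p)
  case (Cons a p)
  then show ?case by (cases p; cases "tl p") auto
qed simp

lemma sum_triples_rev: "sum_triples f (rev p) = sum_triples (\<lambda>x y z. f z y x) p"
proof (induction p rule: induct_list012)
  case (3 x y r)
  then show ?case using sum_triples_glue[of f _ _ y "[x]"] by (cases r) auto
qed auto

lemma all_triples_tl: "all_triples P (x # p) \<Longrightarrow> all_triples P p"
  by (cases p; cases "tl p") auto

lemma all_triples_ne_if_distinct: "distinct p \<Longrightarrow> all_triples (\<lambda>x y z. x \<noteq> z) p"
proof (induction p rule: induct_list012)
  case (3 x y r)
  then show ?case by (cases r) auto
qed auto

lemma nth_append_prefix:
  assumes "2 \<le> length p"
  shows "(p @ q) ! 0 = p ! 0" "(p @ q) ! 1 = p ! 1"
  using assms by (cases p; cases "tl p"; auto)+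

lemma accessible_along_iff_all_triples:
  "accessible_along F \<rho> p \<longleftrightarrow> all_triples (\<lambda>x y z. factor_adj F \<rho> y x z) p"
proof (induction p rule: induct_list012)
  case (3 x y r')
  show ?case
  proof (cases r')
    case r: (Cons z r)
    have "accessible_along F \<rho> (x # y # z # r) \<longleftrightarrow>
        factor_adj F \<rho> y x z \<and> accessible_along F \<rho> (y # z # r)"
    proof
      assume L: "accessible_along F \<rho> (x # y # z # r)"
      have "factor_adj F \<rho> y x z"
        using L[unfolded accessible_along_def, rule_format, of 1] by simp
      moreover have "factor_adj F \<rho> ((y # z # r) ! i) ((y # z # r) ! (i - 1)) ((y # z # r) ! (i + 1))"
        if "0 < i" "i + 1 < length (y # z # r)" for i
        using L[unfolded accessible_along_def, rule_format, of "Suc i"] that by (cases i) auto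
      ultimately show "factor_adj F \<rho> y x z \<and> accessible_along F \<rho> (y # z # r)"
        unfolding accessible_along_def by blast
    next
      assume R: "factor_adj F \<rho> y x z \<and> accessible_along F \<rho> (y # z # r)"
      show "accessible_along F \<rho> (x # y # z # r)"
        unfolding accessible_along_def
      proof (intro allI impI)
        fix i assume i: "0 < i \<and> i + 1 < length (x # y # z # r)"
        show "factor_adj F \<rho> ((x # y # z # r) ! i) ((x # y # z # r) ! (i - 1)) ((x # y # z # r) ! (i + 1))"
        proof (cases "i = 1")
          case False
          then obtain j where "i = Suc (Suc j)" using i by (cases i; cases "i - 1") auto
          then show ?thesis
            using i conjunct2[OF R, unfolded accessible_along_def, rule_format, of "Suc j"] by simp
        qed (use R in simp)
      qed
    qed
    with 3 r show ?thesis by simp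
  qed (auto simp: accessible_along_def)
qed (auto simp: accessible_along_def)

section \<open>Walks and potentials\<close>

text \<open>The handshaking lemma. A new element \<open>a\<close> adds its relations to
  \<open>S\<close> twice: once as the term at \<open>a\<close>, and once through the terms of the
  elements related to it.\<close>

lemma even_sum_symmetric_relation:
  assumes "finite S" "\<And>u v. E u v \<Longrightarrow> E v u" "\<And>u. \<not> E u u"
  shows "even (\<Sum>u\<in>S. card {v \<in> S. E u v})"
  using assms(1)
proof induction
  case (insert a S)
  have step: "card {v \<in> insert a S. E u v} = card {v \<in> S. E u v} + of_bool (E u a)" for u
  proof -
    have "{v \<in> insert a S. E u v} = (if E u a then insert a {v \<in> S. E u v} else {v \<in> S. E u v})"
      by auto
    then show ?thesis using insert.hyps by simp
  qed
  have "(\<Sum>u\<in>S. of_bool (E u a)) = card (S \<inter> {u. E u a})"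
    using insert.hyps by (simp add: of_bool_def sum.If_cases)
  also have "S \<inter> {u. E u a} = {u \<in> S. E a u}" using assms(2) by blast
  finally have "(\<Sum>u\<in>S. card {v \<in> insert a S. E u v}) =
      (\<Sum>u\<in>S. card {v \<in> S. E u v}) + card {u \<in> S. E a u}"
    unfolding step sum.distrib by simp
  moreover have "card {v \<in> insert a S. E a v} = card {v \<in> S. E a v}"
    unfolding step using assms(3) by simp
  ultimately have "(\<Sum>u\<in>insert a S. card {v \<in> insert a S. E u v}) =
      (\<Sum>u\<in>S. card {v \<in> S. E u v}) + 2 * card {v \<in> S. E a v}"
    unfolding sum.insert[OF insert.hyps] by simp
  then show ?case using insert.IH by simp
qed simp

context pair_graph
begin

lemma vwalk_glue: "vwalk (p @ x # q) G \<longleftrightarrow> vwalk (p @ [x]) G \<and> vwalk (x # q) G"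
proof (induction p)
  case Nil
  then show ?case by (cases q) (auto simp: in_arcsD1)
next
  case (Cons a p)
  then show ?case by (cases p) auto
qed

lemma vwalk_rev: "vwalk (rev p) G \<longleftrightarrow> vwalk p G"
proof -
  have "vwalk (rev p) G" if "vwalk p G" for p
    using that arcs_symmetric by (force simp: vwalk_def set_vwalk_arcs_rev)
  from this[of p] this[of "rev p"] show ?thesis by auto
qed

lemma vpath_rev: "vpath (rev p) G \<longleftrightarrow> vpath p G"
  by (simp add: vpath_def vwalk_rev)

lemma vpath_tl: "vpath (x # y # p) G \<Longrightarrow> vpath (y # p) G"
  by (simp add: vpath_def)

text \<open>\<open>cycle\<close> speaks of lists of arcs, whereas walks here are lists of vertices;
  this lemma and the next one translate.\<close>

lemma pawalk_verts_vwalk_arcs: "pawalk_verts u (vwalk_arcs (u # p)) = u # p"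
  by (induction p arbitrary: u) auto

lemma awalk_vwalk_arcs: "vwalk (u # p) G \<Longrightarrow> awalk u (vwalk_arcs (u # p)) (last (u # p))"
  by (induction p arbitrary: u) (auto simp: awalk_def in_arcsD1 simp del: vwalk_arcs_Cons)

lemma finite_neighbours: "finite (neighbours G x)"
  by (rule finite_subset[OF _ pair_finite_verts]) (auto simp: neighbours_def in_arcsD2)

lemma degree_ge_2:
  assumes "(x, y) \<in> parcs G" "(x, z) \<in> parcs G" "y \<noteq> z"
  shows "1 < degree G x"
proof -
  have "card {y, z} \<le> card (neighbours G x)"
    using assms finite_neighbours by (intro card_mono) (auto simp: neighbours_def)
  then show ?thesis using assms by (simp add: degree_def)
qed

lemma connected_crossing:
  assumes "connected G" "S \<inter> pverts G \<noteq> {}" "\<not> pverts G \<subseteq> S"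
  shows "\<exists>u v. (u, v) \<in> parcs G \<and> u \<in> S \<and> v \<notin> S"
proof -
  from assms obtain a b where ab: "a \<in> S" "a \<in> pverts G" "b \<notin> S" "b \<in> pverts G" by auto
  have "a \<rightarrow>\<^sup>*\<^bsub>mk_symmetric G\<^esub> b"
    using assms(1) ab unfolding connected_def strongly_connected_def by auto
  then have "a \<rightarrow>\<^sup>*\<^bsub>G\<^esub> b"
    using reachable_mk_symmetric_eq[OF sym_arcs] by simp
  then have "b \<in> S \<or> (\<exists>u v. (u, v) \<in> parcs G \<and> u \<in> S \<and> v \<notin> S)"
    by (induction rule: reachable_induct) (use ab in auto)
  with ab show ?thesis by simp
qed

lemma walk_sum_append:
  "p \<noteq> [] \<Longrightarrow> q \<noteq> [] \<Longrightarrow> walk_sum f (p @ q) = walk_sum f p + f (last p) (hd q) + walk_sum f q"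
  by (simp add: walk_sum_def vwalk_arcs_append)

lemma walk_sum_rev:
  assumes "\<And>x y. f x y = f y x"
  shows "walk_sum f (rev p) = walk_sum f p"
proof (induction p)
  case (Cons x p)
  show ?case
  proof (cases "p = []")
    case False
    then have "walk_sum f (rev (x # p)) = walk_sum f (rev p) + f (hd p) x"
      using walk_sum_append[of "rev p" "[x]" f] by (simp add: walk_sum_def last_rev)
    also have "\<dots> = walk_sum f (x # p)"
      using False Cons.IH assms by (simp add: walk_sum_def)
    finally show ?thesis .
  qed simp
qed simp

text \<open>Telescoping modulo 2: the potential of each inner vertex enters twice.\<close>

lemma even_walk_sum_potential:
  fixes f :: "'a \<Rightarrow> 'a \<Rightarrow> int"
  assumes \<phi>: "\<forall>(x, y)\<in>parcs G. even (f x y + \<phi> x + \<phi> y)" and "vwalk p G"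
  shows "even (walk_sum f p + \<phi> (hd p) + \<phi> (last p))"
  using assms(2)
proof (induction p rule: induct_list012)
  case (3 x y r)
  then have "even (f x y + \<phi> x + \<phi> y)" using \<phi> by auto
  moreover have "even (walk_sum f (y # r) + \<phi> y + \<phi> (last (y # r)))" using 3 by simp
  ultimately have "even ((f x y + \<phi> x + \<phi> y) + (walk_sum f (y # r) + \<phi> y + \<phi> (last (y # r))))"
    by (rule dvd_add)
  moreover have "(f x y + \<phi> x + \<phi> y) + (walk_sum f (y # r) + \<phi> y + \<phi> (last (y # r))) =
      (f x y + walk_sum f (y # r) + \<phi> x + \<phi> (last (y # r))) + 2 * \<phi> y"
    by simp
  ultimately have "even (f x y + walk_sum f (y # r) + \<phi> x + \<phi> (last (y # r)))"
    by (metis dvd_add_left_iff dvd_triv_left)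
  then show ?case by (simp add: walk_sum_def)
qed (auto simp: walk_sum_def)

text \<open>Vanishing on closed walks means that sums over walks depend modulo 2 only on the end
  points, so summing along a chosen walk from a base vertex gives a potential. For an edge between
  \<open>x\<close> and \<open>y\<close>, the walk to \<open>x\<close>, the edge and the reversed
  walk to \<open>y\<close> form a closed walk.\<close>

lemma even_walk_sum_iff_potential:
  fixes f :: "'a \<Rightarrow> 'a \<Rightarrow> int"
  assumes sym: "\<And>x y. f x y = f y x"
  shows "(\<forall>p. closed_vwalk G p \<longrightarrow> even (walk_sum f p)) \<longleftrightarrow>
    (\<exists>\<phi> :: 'a \<Rightarrow> int. \<forall>(x, y)\<in>parcs G. even (f x y + \<phi> x + \<phi> y))"
proof
  assume "\<exists>\<phi> :: 'a \<Rightarrow> int. \<forall>(x, y)\<in>parcs G. even (f x y + \<phi> x + \<phi> y)"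
  then obtain \<phi> :: "'a \<Rightarrow> int" where \<phi>: "\<forall>(x, y)\<in>parcs G. even (f x y + \<phi> x + \<phi> y)" by blast
  show "\<forall>p. closed_vwalk G p \<longrightarrow> even (walk_sum f p)"
  proof (intro allI impI)
    fix p assume "closed_vwalk G p"
    then have "even (walk_sum f p + \<phi> (hd p) + \<phi> (last p))" "hd p = last p"
      using even_walk_sum_potential[OF \<phi>, of p] by (simp_all add: closed_vwalk_def)
    then show "even (walk_sum f p)" by (simp add: add.assoc)
  qed
next
  assume closed: "\<forall>p. closed_vwalk G p \<longrightarrow> even (walk_sum f p)"
  define conn where "conn z y p \<longleftrightarrow> vwalk p G \<and> hd p = z \<and> last p = y" for z y p
  \<comment> \<open>One base vertex for each component: adjacent vertices define the same predicate
    on \<open>z\<close>, so the choice operator returns the same vertex for both.\<close>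
  define base where "base y = (SOME z. \<exists>p. conn z y p)" for y
  define walk where "walk y = (SOME p. conn (base y) y p)" for y
  have conn_walk: "conn (base y) y (walk y)" if "y \<in> pverts G" for y
  proof -
    have "conn y y [y]" using that by (simp add: conn_def)
    then have "\<exists>z p. conn z y p" by blast
    then have "\<exists>p. conn (base y) y p" unfolding base_def by (rule someI_ex)
    then show ?thesis unfolding walk_def by (rule someI_ex)
  qed
  have conn_step: "\<exists>q. conn z y q" if "conn z x p" "(x, y) \<in> parcs G" for x y z p
  proof -
    have "p \<noteq> []" using that by (auto simp: conn_def vwalk_def)
    then have "conn z y (p @ [y])"
      using that by (auto simp: conn_def vwalk_def vwalk_arcs_append in_arcsD2)
    then show ?thesis by blast
  qed
  have "even (f x y + walk_sum f (walk x) + walk_sum f (walk y))" if xy: "(x, y) \<in> parcs G" for x y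
  proof -
    have "(\<exists>p. conn z x p) \<longleftrightarrow> (\<exists>p. conn z y p)" for z
      using conn_step xy arcs_symmetric by blast
    then have base: "base x = base y" unfolding base_def by simp
    have x: "conn (base x) x (walk x)" and y: "conn (base x) y (walk y)"
      using conn_walk[of x] conn_walk[of y] xy base by (auto simp: in_arcsD1 in_arcsD2)
    have ne: "walk x \<noteq> []" "walk y \<noteq> []" using x y by (auto simp: conn_def vwalk_def)
    have "vwalk (rev (walk y)) G" using y vwalk_rev by (simp add: conn_def)
    then have "vwalk (walk x @ rev (walk y)) G"
      using x y xy ne by (auto simp: conn_def vwalk_def vwalk_arcs_append hd_rev)
    moreover have "hd (walk x @ rev (walk y)) = last (walk x @ rev (walk y))"
      using x y ne by (simp add: conn_def last_rev)
    ultimately have "even (walk_sum f (walk x @ rev (walk y)))"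
      using closed by (simp add: closed_vwalk_def)
    moreover have "walk_sum f (walk x @ rev (walk y)) = f x y + walk_sum f (walk x) + walk_sum f (walk y)"
      using ne x y walk_sum_append[of "walk x" "rev (walk y)" f] walk_sum_rev[of f "walk y", OF sym]
      by (simp add: hd_rev conn_def)
    ultimately show ?thesis by simp
  qed
  then show "\<exists>\<phi> :: 'a \<Rightarrow> int. \<forall>(x, y)\<in>parcs G. even (f x y + \<phi> x + \<phi> y)"
    by (intro exI[of _ "\<lambda>x. walk_sum f (walk x)"]) auto
qed

section \<open>(RC) and its weighted form in terms of potentials\<close>

lemma r_mat_eq:
  assumes "x \<in> pverts G"
  shows "r_mat G x y = of_bool ((x, y) \<in> parcs G) + int (card (neighbours G x \<inter> neighbours G y))"
proof -
  have "(\<Sum>z\<in>pverts G. adj_mat G x z * adj_mat G z y) =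
      (\<Sum>z\<in>pverts G. of_bool (z \<in> neighbours G x \<inter> neighbours G y))"
    using arcs_symmetric by (intro sum.cong) (auto simp: adj_mat_def neighbours_def)
  also have "\<dots> = int (card (pverts G \<inter> (neighbours G x \<inter> neighbours G y)))"
    using pair_finite_verts by (simp add: of_bool_def sum.If_cases Int_def)
  also have "pverts G \<inter> (neighbours G x \<inter> neighbours G y) = neighbours G x \<inter> neighbours G y"
    by (auto simp: neighbours_def in_arcsD2)
  finally show ?thesis by (simp add: r_mat_def adj_mat_def)
qed

lemma adj_mat_sym: "adj_mat G x y = adj_mat G y x"
  using arcs_symmetric by (auto simp: adj_mat_def)

lemma RC_iff_potential:
  "RC G \<longleftrightarrow> (\<exists>\<phi> :: 'a \<Rightarrow> int. \<forall>(x, y)\<in>parcs G. even (r_mat G x y + \<phi> x + \<phi> y))"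
proof -
  have "r_mat G x y = r_mat G y x" for x y
  proof -
    have "adj_mat G x z * adj_mat G z y = adj_mat G y z * adj_mat G z x" for z
      using adj_mat_sym[of x z] adj_mat_sym[of z y] by simp
    then show ?thesis unfolding r_mat_def using adj_mat_sym[of x y] by simp
  qed
  from even_walk_sum_iff_potential[of "r_mat G", OF this]
  show ?thesis by (simp add: RC_def cong_0_iff)
qed

lemma wRC_iff_potential:
  "wRC G w \<longleftrightarrow> (\<exists>\<phi> :: 'a \<Rightarrow> int. \<forall>(x, y)\<in>parcs G. even (wr_mat G w x y + \<phi> x + \<phi> y))"
proof -
  have "wr_mat G w x y = wr_mat G w y x" for x y
    unfolding wr_mat_def using adj_mat_sym[of x y] by (simp add: Int_commute)
  from even_walk_sum_iff_potential[of "wr_mat G w", OF this]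
  show ?thesis by (simp add: wRC_def cong_0_iff)
qed

end

section \<open>Paths in trees\<close>

locale tree_graph =
  fixes T :: "'n pair_pre_digraph"
  assumes undirected_tree: "undirected_tree T"

sublocale tree_graph \<subseteq> pair_graph T
  using undirected_tree by (simp add: undirected_tree_def)

context tree_graph
begin

abbreviation path :: "'n list \<Rightarrow> bool" where
  "path p \<equiv> vpath p (with_proj T)"

text \<open>By induction only the head \<open>x\<close> could recur. As loops and immediate returns
  are excluded, at least two vertices lie between its two occurrences, so the walk back to
  \<open>x\<close> would be a cycle of length at least 3.\<close>

lemma distinct_if_nonbacktracking:
  "vwalk p T \<Longrightarrow> all_triples (\<lambda>x y z. x \<noteq> z) p \<Longrightarrow> distinct p"
proof (induction p)
  case (Cons x p)
  show ?case
  proof (cases p)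
    case (Cons y p')
    then have d: "distinct p" using Cons.IH Cons.prems all_triples_tl[of _ x p] by simp
    moreover have "x \<notin> set p"
    proof
      assume "x \<in> set p"
      then obtain q s where p: "p = q @ x # s" by (meson split_list)
      have w: "vwalk (x # q @ [x]) T"
        using Cons.prems(1) vwalk_glue[of "x # q" x s] by (simp add: p)
      have "q \<noteq> []" using w no_loops[of "(x, x)"] by auto
      moreover have "\<nexists>y. q = [y]" using Cons.prems(2) p by auto
      ultimately have "2 \<le> length q" by (cases q; cases "tl q") auto
      then have "3 \<le> length (vwalk_arcs (x # q @ [x]))"
        using vwalk_length_simp[of "x # q @ [x]"] unfolding vwalk_length_def by simp
      moreover have "cycle (vwalk_arcs (x # q @ [x]))"
        unfolding cycle_def
        using awalk_vwalk_arcs[OF w] pawalk_verts_vwalk_arcs[of x "q @ [x]"] d p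
        by (intro exI[of _ x]) auto
      ultimately show False
        using undirected_tree unfolding undirected_tree_def by blast
    qed
    ultimately show ?thesis by simp
  qed simp
qed simp

text \<open>Turns injectivity into a condition on consecutive triples, which is compatible with
  cutting and gluing at an edge.\<close>

lemma path_iff: "path p \<longleftrightarrow> vwalk p T \<and> all_triples (\<lambda>x y z. x \<noteq> z) p"
  by (auto simp: vpath_def distinct_if_nonbacktracking all_triples_ne_if_distinct)

lemma path_glue: "path (p @ x # y # q) \<longleftrightarrow> path (p @ [x, y]) \<and> path (x # y # q)"
  using vwalk_glue[of p x "y # q"] vwalk_glue[of p x "[y]"]
  by (auto simp: path_iff all_triples_glue[of _ p x y q] in_arcsD2)

lemma path_edge [simp]: "path [x, y] \<longleftrightarrow> (x, y) \<in> parcs T"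
  by (auto simp: path_iff in_arcsD2)

lemma path_Cons3 [simp]: "path (x # y # z # q) \<longleftrightarrow> (x, y) \<in> parcs T \<and> x \<noteq> z \<and> path (y # z # q)"
  by (auto simp: path_iff in_arcsD2)

lemma path_turn:
  assumes "path (x # y # p)" "path (x # z # q)" "y \<noteq> z"
  shows "path (rev p @ y # x # z # q)"
proof -
  have "path (rev p @ [y, x])" using assms(1) vpath_rev[of "x # y # p"] by simp
  moreover have "(y, x) \<in> parcs T"
    using assms(1) by (auto simp: vpath_def intro: arcs_symmetric)
  then have "path (y # x # z # q)" using assms(2,3) by simp
  ultimately show ?thesis by (subst path_glue) simp
qed

text \<open>If the first steps differ, \<open>path_turn\<close> joins the two paths to one injective
  path through \<open>x\<close>, in which the common end point would occur on both sides.\<close>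

lemma path_unique:
  "path (x # p) \<Longrightarrow> path (x # q) \<Longrightarrow> last (x # p) = last (x # q) \<Longrightarrow> p = q"
proof (induction p arbitrary: x q)
  case Nil
  then show ?case by (cases q) (auto simp: vpath_def split: if_splits)
next
  case (Cons a p)
  show ?case
  proof (cases q)
    case Nil
    then show ?thesis using Cons.prems by (auto simp: vpath_def split: if_splits)
  next
    case q: (Cons b q')
    show ?thesis
    proof (cases "a = b")
      case True
      have "path (a # p)" "path (b # q')" "last (a # p) = last (b # q')"
        using Cons.prems vpath_tl[of x a p] vpath_tl[of x b q'] unfolding q by simp_all
      then show ?thesis using Cons.IH[of a q'] True q by blast
    next
      case False
      then have "distinct (rev p @ a # x # b # q')"
        using path_turn[of x a p b q'] Cons.prems(1,2) unfolding q vpath_def by blast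
      moreover have "last (a # p) \<in> set (a # p)" "last (b # q') \<in> set (b # q')"
        by (rule last_in_set; simp)+
      moreover have "last (a # p) = last (b # q')" using Cons.prems q by simp
      ultimately show ?thesis by auto
    qed
  qed
qed

lemma path_unique':
  assumes "path p" "path q" "hd p = hd q" "last p = last q"
  shows "p = q"
proof -
  obtain x p' where p: "p = x # p'" using assms(1) by (cases p) (auto simp: vpath_def)
  obtain y q' where q: "q = y # q'" using assms(2) by (cases q) (auto simp: vpath_def)
  have "x = y" using assms(3) p q by simp
  then show ?thesis using path_unique[of x p' q'] assms(1,2,4) unfolding p q by blast
qed

lemma path_exists:
  assumes "u \<in> pverts T" "v \<in> pverts T"
  shows "\<exists>p. path p \<and> hd p = u \<and> last p = v"
proof -
  have "u \<rightarrow>\<^sup>*\<^bsub>mk_symmetric T\<^esub> v"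
    using undirected_tree assms
    unfolding undirected_tree_def connected_def strongly_connected_def by auto
  then have "u \<rightarrow>\<^sup>*\<^bsub>T\<^esub> v"
    using reachable_mk_symmetric_eq[OF sym_arcs] by simp
  then show ?thesis by (auto simp: reachable_vpath_conv)
qed

lemma path_exists':
  assumes "u \<in> pverts T" "v \<in> pverts T"
  obtains q where "path (u # q)" "last (u # q) = v"
proof -
  from path_exists[OF assms] obtain p where p: "path p" "hd p = u" "last p = v" by blast
  then have "p = u # tl p" by (cases p) (auto simp: vpath_def)
  with p that show ?thesis by metis
qed

text \<open>As long as \<open>y\<close> is not a leaf it has a neighbour other than
  \<open>x\<close>, and the path can be continued. Injectivity bounds its length by the number of
  vertices; the prefix \<open>p\<close> records the part already travelled for this termination
  measure.\<close>

lemma path_to_leaf: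
  assumes "path (p @ [x, y])"
  shows "\<exists>q. path (p @ x # y # q) \<and> last (x # y # q) \<in> leaves T"
  using assms
proof (induction "card (pverts T) - length p" arbitrary: p x y rule: less_induct)
  case less
  have xy: "(x, y) \<in> parcs T" using less.prems path_glue[of p x y "[]"] by simp
  show ?case
  proof (cases "degree T y = 1")
    case True
    then show ?thesis using less.prems xy by (intro exI[of _ "[]"]) (auto simp: leaves_def in_arcsD2)
  next
    case False
    have "\<exists>z. (y, z) \<in> parcs T \<and> z \<noteq> x"
    proof (rule ccontr)
      assume "\<not> ?thesis"
      then have "neighbours T y = {x}"
        using xy by (auto simp: neighbours_def arcs_symmetric)
      with False show False by (simp add: degree_def)
    qed
    then obtain z where z: "(y, z) \<in> parcs T" "z \<noteq> x" by blast
    then have P: "path ((p @ [x]) @ [y, z])"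
      using less.prems path_glue[of p x y "[z]"] xy by simp
    have "distinct (p @ [x, y])" "set (p @ [x, y]) \<subseteq> pverts T"
      using less.prems by (auto simp only: vpath_def vwalk_def with_proj_simps)
    then have "length (p @ [x, y]) \<le> card (pverts T)"
      using pair_finite_verts card_mono distinct_card by metis
    then have "card (pverts T) - length (p @ [x]) < card (pverts T) - length p" by simp
    from less.hyps[OF this P] obtain q where
      "path ((p @ [x]) @ y # z # q)" "last (y # z # q) \<in> leaves T" by blast
    then show ?thesis by (intro exI[of _ "z # q"]) simp
  qed
qed

text \<open>Root the tree at \<open>o'\<close>. Each edge joins a vertex to its parent, so the root
  paths of its two ends differ by exactly this edge, and the sum of \<open>k\<close> along the root
  path is a potential.\<close>

lemma tree_potential:
  fixes k :: "'n \<Rightarrow> 'n \<Rightarrow> int"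
  assumes sym: "\<And>x y. k x y = k y x"
  shows "\<exists>\<psi> :: 'n \<Rightarrow> int. \<forall>(x, y)\<in>parcs T. even (k x y + \<psi> x + \<psi> y)"
proof -
  obtain o' where o: "o' \<in> pverts T"
    using undirected_tree
    unfolding undirected_tree_def connected_def strongly_connected_def by auto
  define P where "P x = (SOME p. path p \<and> hd p = o' \<and> last p = x)" for x
  have P: "path (P x)" "hd (P x) = o'" "last (P x) = x" if "x \<in> pverts T" for x
    using someI_ex[OF path_exists[OF o that]] unfolding P_def by auto
  have P_eq: "P x = p" if "path p" "hd p = o'" "last p = x" for x p
  proof -
    have "x \<in> pverts T" using that last_in_set by (auto simp: vpath_def vwalk_def)
    from path_unique'[OF P(1)[OF this] that(1)] P[OF this] that show ?thesis by simp
  qed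
  have ne: "P x \<noteq> []" if "x \<in> pverts T" for x using P(1)[OF that] by (auto simp: vpath_def vwalk_def)
  have snoc: "walk_sum k (p @ [y]) = walk_sum k p + k (last p) y" if "p \<noteq> []" for p y
    using walk_sum_append[of p "[y]" k] that by (simp add: walk_sum_def)
  have "even (k x y + walk_sum k (P x) + walk_sum k (P y))" if xy: "(x, y) \<in> parcs T" for x y
  proof (cases "path (P x @ [y])")
    case True
    have x: "x \<in> pverts T" using xy by (simp add: in_arcsD1)
    then have "P y = P x @ [y]" using P_eq[OF True] P[OF x] ne[OF x] by simp
    then show ?thesis using snoc[OF ne[OF x], of y] P(3)[OF x] by simp
  next
    case False
    have x: "x \<in> pverts T" using xy by (simp add: in_arcsD1)
    \<comment> \<open>Since the root path of \<open>x\<close> cannot be prolonged by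
      \<open>y\<close>, its last but one vertex must be \<open>y\<close>.\<close>
    obtain p where p: "P x = p @ [x]" using ne[OF x] P(3)[OF x] by (metis append_butlast_last_id)
    then have "p \<noteq> []" using False xy by auto
    then obtain p' z where p': "p = p' @ [z]" by (metis append_butlast_last_id)
    have "path (p' @ [z, x])" using P(1)[OF x] p p' by simp
    moreover have "(z, x) \<in> parcs T" using calculation path_glue[of p' z x "[]"] by simp
    moreover have "\<not> path (p' @ z # x # [y])" using False p p' by simp
    ultimately have z: "z = y" using path_glue[of p' z x "[y]"] xy by auto
    have "path (p' @ [y])"
      using \<open>path (p' @ [z, x])\<close> z vwalk_glue[of p' z "[x]"] by (auto simp: vpath_def)
    moreover have "hd (p' @ [y]) = o'" using P(2)[OF x] p p' z by (cases p') auto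
    ultimately have "P y = p' @ [y]" by (intro P_eq) auto
    then show ?thesis using snoc[of "p' @ [y]" x] p p' z sym[of x y] by simp
  qed
  then show ?thesis by (intro exI[of _ "\<lambda>x. walk_sum k (P x)"]) auto
qed

end

section \<open>Accessible leaves\<close>

sublocale graph_labelled_tree \<subseteq> tree_graph T
  using tree by unfold_locales

context graph_labelled_tree
begin

abbreviation fa :: "'n \<Rightarrow> 'n \<Rightarrow> 'n \<Rightarrow> bool" where
  "fa \<equiv> factor_adj F \<rho>"

abbreviation acc :: "'n list \<Rightarrow> bool" where
  "acc \<equiv> accessible_along F \<rho>"

abbreviation G :: "'n pair_pre_digraph" where
  "G \<equiv> accessibility_graph T F \<rho>"

text \<open>Indexed by oriented tree edges: when the edge between \<open>x\<close> and
  \<open>y\<close> is removed, these leaves lie on the side of \<open>y\<close>.\<close>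

definition branch :: "'n \<Rightarrow> 'n \<Rightarrow> 'n set" where
  "branch x y = {v \<in> leaves T. \<exists>q. path (x # y # q) \<and> last (x # y # q) = v}"

text \<open>The set \<open>immediately_accessible\<close> indexed by an oriented tree edge instead
  of a factor vertex. It thus also makes sense for a leaf \<open>x\<close>, where it turns out to be
  the neighbourhood of \<open>x\<close> in \<open>G\<close>.\<close>

definition access :: "'n \<Rightarrow> 'n \<Rightarrow> 'n set" where
  "access x y = {v \<in> leaves T. \<exists>q. path (x # y # q) \<and> last (x # y # q) = v \<and> acc (x # y # q)}"

lemma acc_Cons3 [simp]: "acc (x # y # z # r) \<longleftrightarrow> fa y x z \<and> acc (y # z # r)"
  by (simp add: accessible_along_iff_all_triples)

lemma acc_edge [simp]: "acc [x, y]"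
  by (simp add: accessible_along_iff_all_triples)

lemma acc_glue: "acc (p @ x # y # q) \<longleftrightarrow> acc (p @ [x, y]) \<and> acc (x # y # q)"
  unfolding accessible_along_iff_all_triples by (rule all_triples_glue)

lemma nodesI: "(y, x) \<in> parcs T \<Longrightarrow> (y, z) \<in> parcs T \<Longrightarrow> x \<noteq> z \<Longrightarrow> y \<in> nodes T"
  using degree_ge_2 by (auto simp: nodes_def in_arcsD1)

lemma path_interior: "path (x # y # z # r) \<Longrightarrow> y \<in> nodes T"
  by (cases r) (auto intro!: nodesI[of y x z] arcs_symmetric simp: vpath_def)

lemma node_not_leaf: "x \<in> nodes T \<Longrightarrow> x \<notin> leaves T"
  by (auto simp: nodes_def leaves_def)

lemma fa_sym: 
  assumes "y \<in> nodes T"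
  shows "fa y x z \<longleftrightarrow> fa y z x"
proof -
  interpret F: pair_graph "F y" using factor assms .
  show ?thesis unfolding factor_adj_def using F.arcs_symmetric by blast
qed

lemma fa_iff:
  assumes "x \<in> nodes T" "u \<in> pverts (F x)" "v \<in> pverts (F x)"
  shows "fa x (\<rho> x u) (\<rho> x v) \<longleftrightarrow> (u, v) \<in> parcs (F x)"
proof -
  interpret F: pair_graph "F x" using factor assms by simp
  have "inj_on (\<rho> x) (pverts (F x))" using bij assms by (simp add: bij_betw_def)
  then show ?thesis
    unfolding factor_adj_def using assms by (auto dest: inj_onD F.in_arcsD1 F.in_arcsD2)
qed

lemma fa_image:
  assumes "x \<in> nodes T" "u \<in> pverts (F x)"
  shows "{z. fa x (\<rho> x u) z} = \<rho> x ` neighbours (F x) u"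
proof -
  interpret F: pair_graph "F x" using factor assms by simp
  have "inj_on (\<rho> x) (pverts (F x))" using bij assms by (simp add: bij_betw_def)
  then show ?thesis
    unfolding factor_adj_def neighbours_def using assms
    by (auto dest: inj_onD F.in_arcsD1 F.in_arcsD2)
qed

lemma fa_neighbours:
  assumes "y \<in> nodes T" "fa y x z"
  shows "(y, x) \<in> parcs T" "(y, z) \<in> parcs T" "x \<noteq> z"
proof -
  interpret F: pair_graph "F y" using factor assms by simp
  have b: "bij_betw (\<rho> y) (pverts (F y)) (neighbours T y)" using bij assms by simp
  from assms obtain u v where uv: "(u, v) \<in> parcs (F y)" "\<rho> y u = x" "\<rho> y v = z"
    by (auto simp: factor_adj_def)
  then have "u \<in> pverts (F y)" "v \<in> pverts (F y)" "u \<noteq> v"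
    using F.no_loops' by (auto simp: F.in_arcsD1 F.in_arcsD2)
  with uv b show "(y, x) \<in> parcs T" "(y, z) \<in> parcs T" "x \<noteq> z"
    by (auto simp: bij_betw_def neighbours_def inj_on_def)
qed

lemma acc_rev: "path p \<Longrightarrow> acc (rev p) \<longleftrightarrow> acc p"
proof (induction p rule: induct_list012)
  case (3 x y r)
  show ?case
  proof (cases r)
    case (Cons z r')
    have "path (y # r)" using 3 vpath_tl by blast
    moreover have "fa y z x \<longleftrightarrow> fa y x z" using fa_sym path_interior 3(3) Cons by blast
    ultimately show ?thesis using 3(2)[OF \<open>path (y # r)\<close>] Cons acc_glue[of "rev r'" z y "[x]"] by auto
  qed (simp add: accessible_along_iff_all_triples)
qed (auto simp: accessible_along_iff_all_triples)

lemma finite_leaves: "finite (leaves T)"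
  using pair_finite_verts by (simp add: leaves_def)

lemma finite_access [simp]: "finite (access x y)"
  using finite_leaves by (simp add: access_def)

lemma access_subset_branch: "access x y \<subseteq> branch x y"
  by (auto simp: access_def branch_def)

lemma mem_branch:
  assumes "path (x # y # q)" "last (x # y # q) \<in> leaves T"
  shows "last (x # y # q) \<in> branch x y"
  using assms unfolding branch_def by blast

lemma branchE:
  assumes "v \<in> branch x y"
  obtains q where "path (x # y # q)" "last (x # y # q) = v" "v \<in> leaves T"
  using assms unfolding branch_def by blast

text \<open>Uniqueness of tree paths removes the existential quantifier in \<open>access\<close>.
  The first edge is given by indices so that the lemma also fits reversed and appended
  lists.\<close>

lemma mem_access:
  assumes "path p" "2 \<le> length p" "last p \<in> leaves T"
  shows "last p \<in> access (p ! 0) (p ! 1) \<longleftrightarrow> acc p"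
proof -
  obtain x y q where p: "p = x # y # q" using assms(2) by (cases p; cases "tl p") auto
  show ?thesis
  proof
    assume "last p \<in> access (p ! 0) (p ! 1)"
    then obtain q' where q': "path (x # y # q')" "last (x # y # q') = last (x # y # q)" "acc (x # y # q')"
      unfolding access_def p by auto
    then have "x # y # q' = x # y # q"
      using assms(1) by (intro path_unique') (auto simp: p simp del: path_Cons3)
    then show "acc p" using q' p by simp
  qed (use assms p in \<open>auto simp: access_def simp del: last.simps path_Cons3 acc_Cons3\<close>)
qed

lemma mem_access_Cons:
  assumes "path (x # y # q)" "last (x # y # q) \<in> leaves T"
  shows "last (x # y # q) \<in> access x y \<longleftrightarrow> acc (x # y # q)"
  using mem_access[of "x # y # q"] assms by simp

section \<open>Partition of the leaves into branches, and recursion for accessible leaves\<close>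

lemma branch_disjoint: "z \<noteq> z' \<Longrightarrow> branch x z \<inter> branch x z' = {}"
proof (rule ccontr)
  assume "z \<noteq> z'" "branch x z \<inter> branch x z' \<noteq> {}"
  then obtain v where "v \<in> branch x z" "v \<in> branch x z'" by blast
  then obtain q q' where "path (x # z # q)" "path (x # z' # q')"
    "last (x # z # q) = last (x # z' # q')"
    by (metis branchE)
  from path_unique[OF this] \<open>z \<noteq> z'\<close> show False by simp
qed

lemma branch_opposite_disjoint: "branch x y \<inter> branch y x = {}"
proof (rule ccontr)
  assume "branch x y \<inter> branch y x \<noteq> {}"
  then obtain v where "v \<in> branch x y" "v \<in> branch y x" by blast
  then obtain q q' where p: "path (x # y # q)" "path (y # x # q')"
    and l: "last (x # y # q) = last (y # x # q')"
    by (metis branchE)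
  have "path (rev q' @ [x, y])" using vpath_rev[of "y # x # q'"] p(2) by simp
  then have "distinct (rev q' @ x # y # q)" using p(1) path_glue unfolding vpath_def by blast
  moreover have "last (y # q) \<in> set (y # q)" "last (x # q') \<in> set (x # q')"
    by (rule last_in_set; simp)+
  ultimately show False using l by auto
qed

lemma branch_cover:
  assumes "(x, y) \<in> parcs T"
  shows "leaves T \<subseteq> branch x y \<union> branch y x"
proof
  fix v assume v: "v \<in> leaves T"
  then obtain q where q: "path (x # q)" "last (x # q) = v"
    using path_exists'[of x v] assms by (auto simp: leaves_def in_arcsD1)
  show "v \<in> branch x y \<union> branch y x"
  proof (cases "\<exists>q'. q = y # q'")
    case True
    then show ?thesis using q v mem_branch by blast
  next
    case False
    then have "path (y # x # q)"
      using q assms arcs_symmetric by (cases q) auto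
    then show ?thesis using q v mem_branch[of y x q] by simp
  qed
qed

text \<open>A node is not a leaf, so a path entering \<open>y\<close> from \<open>x\<close> has to
  go on to some \<open>z\<close>, and accessibility at \<open>y\<close> is the condition on this
  step.\<close>

lemma access_rec:
  assumes "(x, y) \<in> parcs T" "y \<in> nodes T"
  shows "access x y = (\<Union>z\<in>{z. fa y x z}. access y z)"
proof (intro equalityI subsetI)
  fix v assume "v \<in> access x y"
  then obtain q where q: "v \<in> leaves T" "path (x # y # q)" "last (x # y # q) = v" "acc (x # y # q)"
    unfolding access_def by auto
  then obtain z q' where "q = z # q'"
    using node_not_leaf assms(2) by (cases q) auto
  then show "v \<in> (\<Union>z\<in>{z. fa y x z}. access y z)"
    using q by (auto simp: access_def intro!: exI[of _ z] exI[of _ q'])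
next
  fix v assume "v \<in> (\<Union>z\<in>{z. fa y x z}. access y z)"
  then obtain z q where z: "fa y x z" "v \<in> leaves T" "path (y # z # q)" "last (y # z # q) = v" "acc (y # z # q)"
    unfolding access_def by auto
  then have "path (x # y # z # q)" "acc (x # y # z # q)"
    using fa_neighbours[OF assms(2) z(1)] assms(1) by auto
  then show "v \<in> access x y"
    using z unfolding access_def by (intro CollectI conjI exI[of _ "z # q"]) auto
qed

lemma finite_fa: "y \<in> nodes T \<Longrightarrow> finite {z. fa y x z}"
  by (rule finite_subset[OF _ finite_neighbours[of y]]) (auto simp: neighbours_def fa_neighbours)

lemma access_disjoint: "z \<noteq> z' \<Longrightarrow> access x z \<inter> access x z' = {}"
  using branch_disjoint access_subset_branch by blast

lemma card_access_rec:
  assumes "(x, y) \<in> parcs T" "y \<in> nodes T"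
  shows "card (access x y) = (\<Sum>z | fa y x z. card (access y z))"
  unfolding access_rec[OF assms]
  using finite_fa[OF assms(2)] access_disjoint by (intro card_UN_disjoint) auto

lemma access_leaf:
  assumes "(x, y) \<in> parcs T" "y \<in> leaves T"
  shows "access x y = {y}"
proof
  show "access x y \<subseteq> {y}"
  proof
    fix v assume "v \<in> access x y"
    then obtain q where "path (x # y # q)" "last (x # y # q) = v"
      unfolding access_def by auto
    then show "v \<in> {y}" using path_interior node_not_leaf assms(2) by (cases q) auto
  qed
  show "{y} \<subseteq> access x y"
    using mem_access_Cons[of x y "[]"] assms by simp
qed

section \<open>Factor weights as numbers of accessible leaves\<close>

lemma weight_eq: "weight T F \<rho> x u = int (card (access x (\<rho> x u)))"
  by (simp add: weight_def immediately_accessible_def access_def)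

lemma rho_neighbour: "x \<in> nodes T \<Longrightarrow> u \<in> pverts (F x) \<Longrightarrow> (x, \<rho> x u) \<in> parcs T"
  using bij[of x] by (auto simp: bij_betw_def neighbours_def)

lemma rho_surj:
  assumes "x \<in> nodes T" "(x, a) \<in> parcs T"
  obtains u where "u \<in> pverts (F x)" "\<rho> x u = a"
  using bij[of x] assms by (force simp: bij_betw_def neighbours_def)

text \<open>This is the recursion for the reversed edge: an accessible path entering
  \<open>x\<close> from \<open>\<rho> x u\<close> goes on through the neighbours of
  \<open>u\<close>. Hence weighted (EN1) at \<open>u\<close> compares the two opposite numbers of
  accessible leaves at one tree edge.\<close>

lemma sum_weight_neighbours:
  assumes "x \<in> nodes T" "u \<in> pverts (F x)"
  shows "sum (weight T F \<rho> x) (neighbours (F x) u) = int (card (access (\<rho> x u) x))"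
proof -
  interpret F: pair_graph "F x" using factor assms by simp
  have inj: "inj_on (\<rho> x) (neighbours (F x) u)"
    using bij[OF assms(1)] by (rule inj_on_subset[OF bij_betw_imp_inj_on])
      (auto simp: neighbours_def F.in_arcsD2)
  show ?thesis
    using card_access_rec[OF arcs_symmetric[OF rho_neighbour[OF assms]] assms(1)]
    by (simp add: fa_image[OF assms] sum.reindex[OF inj] weight_eq)
qed

text \<open>The weight of a common neighbourhood in the factor at \<open>x\<close>, transported by
  \<open>\<rho> x\<close> to tree neighbours.\<close>

definition common_weight :: "'n \<Rightarrow> 'n \<Rightarrow> 'n \<Rightarrow> int" where
  "common_weight x a b = (\<Sum>z | fa x a z \<and> fa x b z. int (card (access x z)))"

lemma wr_mat_eq:
  assumes "x \<in> nodes T" "u \<in> pverts (F x)" "v \<in> pverts (F x)"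
  shows "wr_mat (F x) (weight T F \<rho> x) u v =
    of_bool (fa x (\<rho> x u) (\<rho> x v)) + common_weight x (\<rho> x u) (\<rho> x v)"
proof -
  interpret F: pair_graph "F x" using factor assms by simp
  have inj: "inj_on (\<rho> x) (pverts (F x))" using bij assms by (simp add: bij_betw_def)
  have sub: "neighbours (F x) w \<subseteq> pverts (F x)" for w
    by (auto simp: neighbours_def F.in_arcsD2)
  have "{z. fa x (\<rho> x u) z \<and> fa x (\<rho> x v) z} = {z. fa x (\<rho> x u) z} \<inter> {z. fa x (\<rho> x v) z}"
    by blast
  also have "\<dots> = \<rho> x ` (neighbours (F x) u \<inter> neighbours (F x) v)"
    unfolding fa_image[OF assms(1,2)] fa_image[OF assms(1,3)]
    using inj_on_image_Int[OF inj sub sub] by simp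
  finally have *: "{z. fa x (\<rho> x u) z \<and> fa x (\<rho> x v) z} =
      \<rho> x ` (neighbours (F x) u \<inter> neighbours (F x) v)" .
  have "inj_on (\<rho> x) (neighbours (F x) u \<inter> neighbours (F x) v)"
    using inj sub by (blast intro: inj_on_subset)
  then show ?thesis
    unfolding wr_mat_def common_weight_def * by (simp add: sum.reindex weight_eq adj_mat_def fa_iff[OF assms])
qed

section \<open>The accessibility graph\<close>

lemma leaf_neighbourE:
  assumes "v \<in> leaves T"
  obtains y where "(v, y) \<in> parcs T" "\<And>z. (v, z) \<in> parcs T \<Longrightarrow> z = y"
proof -
  obtain y where "neighbours T v = {y}"
    using assms by (auto simp: leaves_def degree_def card_1_singleton_iff)
  with that show thesis by (auto simp: neighbours_def)
qed

lemma adj_iff: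
  assumes "path p" "hd p \<in> leaves T" "last p \<in> leaves T" "hd p \<noteq> last p"
  shows "(hd p, last p) \<in> parcs G \<longleftrightarrow> acc p"
proof
  assume "(hd p, last p) \<in> parcs G"
  then obtain q where "path q" "hd q = hd p" "last q = last p" "acc q"
    by (auto simp: accessibility_graph_def)
  with path_unique'[of q p] assms show "acc p" by simp
qed (use assms in \<open>auto simp: accessibility_graph_def\<close>)

lemma adjE:
  assumes "(u, v) \<in> parcs G"
  obtains p where "path p" "hd p = u" "last p = v" "acc p" "u \<in> leaves T" "v \<in> leaves T" "u \<noteq> v"
  using assms by (auto simp: accessibility_graph_def)

lemma pverts_accessibility [simp]: "pverts G = leaves T"
  by (simp add: accessibility_graph_def)

lemma pair_graph_accessibility: "pair_graph G"
proof -
  have sub: "parcs G \<subseteq> leaves T \<times> leaves T" by (auto simp: accessibility_graph_def)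
  have "(v, u) \<in> parcs G" if "(u, v) \<in> parcs G" for u v
  proof -
    from that obtain p where p: "path p" "hd p = u" "last p = v" "acc p" "u \<in> leaves T" "v \<in> leaves T" "u \<noteq> v"
      by (rule adjE)
    have "p \<noteq> []" using p(1) by (auto simp: vpath_def vwalk_def)
    then have "path (rev p)" "hd (rev p) = v" "last (rev p) = u" "acc (rev p)"
      using p vpath_rev acc_rev by (auto simp: hd_rev last_rev)
    with adj_iff[of "rev p"] p show ?thesis by auto
  qed
  then have "symmetric (with_proj G)" by (auto simp: symmetric_def intro: symI)
  moreover have "finite (parcs G)"
    using finite_subset[OF sub] finite_leaves by simp
  moreover have "fst e \<in> leaves T" "snd e \<in> leaves T" "fst e \<noteq> snd e" if "e \<in> parcs G" for e
    using that by (auto simp: accessibility_graph_def)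
  ultimately show ?thesis using finite_leaves by unfold_locales auto
qed

sublocale G: pair_graph G
  by (rule pair_graph_accessibility)

lemma list2E:
  assumes "2 \<le> length p"
  obtains x y q where "p = x # y # q"
  using assms by (cases p; cases "tl p") auto

text \<open>A leaf has a single tree neighbour, so all paths from it begin with the first edge of
  \<open>p\<close>.\<close>

lemma neighbours_accessibility:
  assumes "path p" "2 \<le> length p" "hd p \<in> leaves T"
  shows "neighbours G (hd p) = access (p ! 0) (p ! 1)"
proof -
  obtain v y q where p: "p = v # y # q" using assms(2) by (rule list2E)
  have v: "v \<in> leaves T" "(v, y) \<in> parcs T" using assms p by (auto simp: vpath_def)
  have "u \<in> neighbours G v \<longleftrightarrow> u \<in> access v y" for u
  proof
    assume "u \<in> neighbours G v"
    then have "(v, u) \<in> parcs G" by (simp add: neighbours_def)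
    then obtain p' where p': "path p'" "hd p' = v" "last p' = u" "acc p'" "u \<in> leaves T" "v \<noteq> u"
      by (rule adjE)
    then have "2 \<le> length p'" by (cases p'; cases "tl p'") (auto simp: vpath_def vwalk_def)
    then obtain y' q' where q': "p' = v # y' # q'" using p'(2) by (auto elim: list2E)
    then have "(v, y') \<in> parcs T" using p'(1) by (auto simp: vpath_def)
    then have "y' = y" using v by (metis leaf_neighbourE)
    then show "u \<in> access v y" using p' q' unfolding access_def by blast
  next
    assume "u \<in> access v y"
    then obtain q' where q': "u \<in> leaves T" "path (v # y # q')" "last (v # y # q') = u" "acc (v # y # q')"
      unfolding access_def by blast
    moreover have "v \<noteq> u"
    proof
      assume "v = u"
      moreover have "last (y # q') \<in> set (y # q')" by (rule last_in_set) simp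
      ultimately show False using q'(2,3) by (auto simp: vpath_def)
    qed
    ultimately have "(v, u) \<in> parcs G" using adj_iff[of "v # y # q'"] v by simp
    then show "u \<in> neighbours G v" by (simp add: neighbours_def)
  qed
  then show ?thesis using p by auto
qed

text \<open>The path from \<open>u\<close> to \<open>v\<close> runs through the edge between
  \<open>x\<close> and \<open>y\<close>, and its accessibility is that of the two halves. The edges
  of \<open>G\<close> across a tree edge therefore form a complete bipartite graph, that is, a split
  of \<open>G\<close>.\<close>

lemma crossing_iff:
  assumes "(x, y) \<in> parcs T" "u \<in> branch y x" "v \<in> branch x y"
  shows "(u, v) \<in> parcs G \<longleftrightarrow> u \<in> access y x \<and> v \<in> access x y"
proof -
  obtain p where p: "path (y # x # p)" "last (y # x # p) = u" "u \<in> leaves T"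
    using assms(2) by (rule branchE)
  obtain q where q: "path (x # y # q)" "last (x # y # q) = v" "v \<in> leaves T"
    using assms(3) by (rule branchE)
  have "path (rev p @ [x, y])" using vpath_rev[of "y # x # p"] p(1) by simp
  then have P: "path (rev p @ x # y # q)" using q(1) path_glue by blast
  have "u \<noteq> v" using assms branch_opposite_disjoint by blast
  moreover have "hd (rev p @ x # y # q) = u" using p(2) by (cases p rule: rev_cases) auto
  moreover have "last (rev p @ x # y # q) = v" using q(2) by simp
  ultimately have "(u, v) \<in> parcs G \<longleftrightarrow> acc (rev p @ x # y # q)"
    using adj_iff[OF P] p(3) q(3) by simp
  also have "\<dots> \<longleftrightarrow> acc (rev (y # x # p)) \<and> acc (x # y # q)"
    using acc_glue[of "rev p" x y q] by simp
  also have "\<dots> \<longleftrightarrow> u \<in> access y x \<and> v \<in> access x y"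
    using acc_rev[OF p(1)] mem_access_Cons[of y x p] mem_access_Cons[of x y q] p q by simp
  finally show ?thesis .
qed

lemma branch_subset_leaves: "branch x y \<subseteq> leaves T"
  by (auto simp: branch_def)

lemma branch_nonempty: "(x, y) \<in> parcs T \<Longrightarrow> branch x y \<noteq> {}"
  using path_to_leaf[of "[]" x y] mem_branch by auto

text \<open>Both branches contain leaves, so connectedness of \<open>G\<close> provides an edge
  between them, and its end in \<open>branch x y\<close> is accessible. This is how connectedness
  enters (EN2) and (RC).\<close>

lemma access_nonempty:
  assumes "connected G" "(x, y) \<in> parcs T"
  shows "access x y \<noteq> {}"
proof -
  have "branch y x \<inter> pverts G \<noteq> {}"
    using branch_nonempty[OF arcs_symmetric[OF assms(2)]] branch_subset_leaves by auto
  moreover have "\<not> pverts G \<subseteq> branch y x"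
    using branch_nonempty[OF assms(2)] branch_opposite_disjoint[of x y] branch_subset_leaves[of x y]
    by auto
  ultimately obtain u v where uv: "(u, v) \<in> parcs G" "u \<in> branch y x" "v \<notin> branch y x"
    using G.connected_crossing[OF assms(1)] by blast
  then have "v \<in> leaves T" using G.in_arcsD2 by fastforce
  with uv have "v \<in> branch x y" using branch_cover[OF assms(2)] by blast
  with crossing_iff[OF assms(2) uv(2)] uv(1) show ?thesis by blast
qed

text \<open>Handshaking inside the branch: the degree sum and twice the inner edges are even.\<close>

lemma even_crossing:
  assumes "EN1 G" "(x, y) \<in> parcs T"
  shows "even (card (access x y) * card (access y x))"
proof -
  define S where "S = branch x y"
  have fin: "finite S" "finite (branch y x)"
    using finite_leaves by (auto simp: S_def branch_def)
  have S_leaves: "S \<subseteq> leaves T" by (auto simp: S_def branch_def)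
  have deg: "degree G v = card {u \<in> S. (v, u) \<in> parcs G} + card {u \<in> branch y x. (v, u) \<in> parcs G}" for v
  proof -
    have "u \<in> S \<union> branch y x" if "(v, u) \<in> parcs G" for u
      using that branch_cover[OF assms(2)] G.in_arcsD2[OF that] by (auto simp: S_def)
    then have "neighbours G v = {u \<in> S. (v, u) \<in> parcs G} \<union> {u \<in> branch y x. (v, u) \<in> parcs G}"
      by (auto simp: neighbours_def)
    then show ?thesis
      unfolding degree_def using fin branch_opposite_disjoint[of x y]
      by (simp only:) (intro card_Un_disjoint; auto simp: S_def)
  qed
  \<comment> \<open>By the complete bipartite structure, \<open>v\<close> is adjacent to all of
    \<open>access y x\<close> or to nothing in the opposite branch.\<close>
  have "card {u \<in> branch y x. (v, u) \<in> parcs G} = of_bool (v \<in> access x y) * card (access y x)"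
    if "v \<in> S" for v
  proof -
    have "{u \<in> branch y x. (v, u) \<in> parcs G} = (if v \<in> access x y then access y x else {})"
      using crossing_iff[OF assms(2)] that G.arcs_symmetric access_subset_branch unfolding S_def
      by (auto; blast)
    then show ?thesis by simp
  qed
  then have "(\<Sum>v\<in>S. card {u \<in> branch y x. (v, u) \<in> parcs G}) =
      (\<Sum>v\<in>S. of_bool (v \<in> access x y)) * card (access y x)"
    by (simp add: sum_distrib_right)
  also have "(\<Sum>v\<in>S. of_bool (v \<in> access x y)) = card (S \<inter> access x y)"
    using fin by (simp add: of_bool_def sum.If_cases)
  also have "S \<inter> access x y = access x y"
    using access_subset_branch by (auto simp: S_def)
  finally have "(\<Sum>v\<in>S. degree G v) =
      (\<Sum>v\<in>S. card {u \<in> S. (v, u) \<in> parcs G}) + card (access x y) * card (access y x)"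
    by (simp add: deg sum.distrib)
  moreover have "even (\<Sum>v\<in>S. degree G v)"
    using assms(1) S_leaves by (intro dvd_sum) (auto simp: EN1_def)
  moreover have "even (\<Sum>v\<in>S. card {u \<in> S. (v, u) \<in> parcs G})"
    using fin G.arcs_symmetric G.no_loops' by (intro even_sum_symmetric_relation) auto
  ultimately show ?thesis by simp
qed

section \<open>Condition (EN1)\<close>

lemma leaf_neighbour_node:
  assumes "nodes T \<noteq> {}" "v \<in> leaves T" "(v, y) \<in> parcs T"
  shows "y \<in> nodes T"
proof -
  obtain x where x: "x \<in> nodes T" using assms(1) by blast
  obtain q where q: "path (v # q)" "last (v # q) = x"
    using path_exists'[of v x] x assms(3) by (auto simp: nodes_def in_arcsD1)
  then obtain y' q' where "q = y' # q'" using x assms(2) node_not_leaf by (cases q) auto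
  moreover from this have "(v, y') \<in> parcs T" using q(1) by (auto simp: vpath_def)
  then have "y' = y" using assms by (metis leaf_neighbourE)
  ultimately show ?thesis using q x path_interior by (cases q') auto
qed

text \<open>The assumption on \<open>nodes T\<close> excludes the tree with a single edge: there
  \<open>G\<close> is a single edge with odd degrees, and no factor exists that could detect
  this.\<close>

theorem EN1_iff:
  assumes "nodes T \<noteq> {}"
  shows "EN1 G \<longleftrightarrow> (\<forall>x\<in>nodes T. wEN1 (F x) (weight T F \<rho> x))"
proof
  assume EN1: "EN1 G"
  show "\<forall>x\<in>nodes T. wEN1 (F x) (weight T F \<rho> x)"
    unfolding wEN1_def
  proof (intro ballI impI)
    fix x u assume x: "x \<in> nodes T" and u: "u \<in> pverts (F x)" and w: "weight T F \<rho> x u = 1"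
    have "even (card (access (\<rho> x u) x))"
      using even_crossing[OF EN1 rho_neighbour[OF x u]] w by (simp add: weight_eq)
    then show "[sum (weight T F \<rho> x) (neighbours (F x) u) = 0] (mod 2)"
      by (simp add: sum_weight_neighbours x u cong_0_iff)
  qed
next
  assume wEN1: "\<forall>x\<in>nodes T. wEN1 (F x) (weight T F \<rho> x)"
  show "EN1 G"
    unfolding EN1_def
  proof
    fix v assume "v \<in> pverts G"
    then have v: "v \<in> leaves T" by simp
    obtain y where vy: "(v, y) \<in> parcs T" using leaf_neighbourE[OF v] by blast
    have y: "y \<in> nodes T" using leaf_neighbour_node assms v vy by blast
    obtain u where u: "u \<in> pverts (F y)" "\<rho> y u = v" using rho_surj[OF y] vy arcs_symmetric by blast
    have "weight T F \<rho> y u = 1"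
      using u access_leaf[OF arcs_symmetric[OF vy] v] by (simp add: weight_eq)
    then have "[sum (weight T F \<rho> y) (neighbours (F y) u) = 0] (mod 2)"
      using wEN1 y u by (auto simp: wEN1_def)
    then have "even (card (access v y))"
      using u by (simp add: sum_weight_neighbours y cong_0_iff)
    then show "even (degree G v)"
      using neighbours_accessibility[of "[v, y]"] v vy by (simp add: degree_def)
  qed
qed

section \<open>Common neighbours along a path\<close>

text \<open>Defined for all paths, so that vertices can be stripped off one by one. For a path
  between two leaves it is their common neighbourhood in \<open>G\<close>.\<close>

definition common :: "'n list \<Rightarrow> 'n set" where
  "common p = access (p ! 0) (p ! 1) \<inter> access (rev p ! 0) (rev p ! 1)"

lemma common_eq_neighbours:
  assumes "path p" "2 \<le> length p" "hd p \<in> leaves T" "last p \<in> leaves T"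
  shows "common p = neighbours G (hd p) \<inter> neighbours G (last p)"
proof -
  have "p \<noteq> []" using assms by auto
  then show ?thesis
    using neighbours_accessibility[of p] neighbours_accessibility[of "rev p"] assms vpath_rev
    by (simp add: common_def hd_rev)
qed

lemma common_edge [simp]: "common [x, y] = {}"
  using branch_opposite_disjoint[of x y] access_subset_branch[of x y] access_subset_branch[of y x]
  by (auto simp: common_def)

text \<open>The leaves reached from \<open>x\<close> are sorted by the vertex \<open>w\<close> that
  follows \<open>y\<close>. Those with \<open>w = z\<close> are the common leaves of the shorter
  path, counted if the step through \<open>y\<close> is allowed. Those with
  \<open>w \<noteq> z\<close> branch off at \<open>y\<close>; seen from the far end, they require
  accessibility of the whole rest and adjacency of \<open>z\<close> and \<open>w\<close> in the
  factor at \<open>y\<close>.\<close>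

lemma card_common_rec:
  assumes "path (x # y # z # r)"
  shows "int (card (common (x # y # z # r))) =
    of_bool (fa y x z) * int (card (common (y # z # r))) +
    of_bool (acc (y # z # r)) * common_weight y x z"
proof -
  define L where "L = y # z # r"
  \<comment> \<open>The leaves accessible from the far end; prepending \<open>x\<close> does not
    change this set.\<close>
  define E where "E = access (rev L ! 0) (rev L ! 1)"
  have y: "y \<in> nodes T" and xy: "(x, y) \<in> parcs T" and L: "path L"
    using assms path_interior vpath_tl by (auto simp: L_def)
  have "common (x # L) = access x y \<inter> E"
  proof -
    have "rev (x # L) ! 0 = rev L ! 0" "rev (x # L) ! 1 = rev L ! 1"
      using nth_append_prefix[of "rev L" "[x]"] by (simp_all add: L_def)
    then show ?thesis by (simp only: common_def E_def) (simp add: L_def)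
  qed
  also have "\<dots> = (\<Union>w\<in>{w. fa y x w}. access y w \<inter> E)"
    using access_rec[OF xy y] by auto
  finally have union: "common (x # L) = (\<Union>w\<in>{w. fa y x w}. access y w \<inter> E)" .
  have "card (common (x # L)) = (\<Sum>w | fa y x w. card (access y w \<inter> E))"
    unfolding union
  proof (intro card_UN_disjoint ballI impI)
    show "access y w \<inter> E \<inter> (access y w' \<inter> E) = {}" if "w \<noteq> w'" for w w'
      using access_disjoint[OF that] by blast
  qed (use finite_fa[OF y] in auto)
  also have "\<dots> = (\<Sum>w | fa y x w. (if w = z then card (common L) else 0) +
      (if acc L \<and> fa y z w then card (access y w) else 0))"
  proof (intro sum.cong refl)
    fix w assume "w \<in> {w. fa y x w}"
    then have yw: "(y, w) \<in> parcs T" using fa_neighbours y by auto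
    show "card (access y w \<inter> E) = (if w = z then card (common L) else 0) +
      (if acc L \<and> fa y z w then card (access y w) else 0)"
    proof (cases "w = z")
      case True
      then have "\<not> fa y z w" using fa_neighbours(3)[OF y] by blast
      moreover have "common L = access y z \<inter> E" by (simp add: common_def E_def L_def)
      ultimately show ?thesis using True by simp
    next
      case False
      have "v \<in> E \<longleftrightarrow> acc L \<and> fa y z w" if "v \<in> access y w" for v
      proof -
        from that obtain q where q: "v \<in> leaves T" "path (y # w # q)" "last (y # w # q) = v" "acc (y # w # q)"
          unfolding access_def by blast
        \<comment> \<open>The path from the far end of \<open>L\<close> back to \<open>y\<close> and
          from there out to the leaf \<open>v\<close>.\<close>
        define P where "P = rev r @ z # y # w # q"
        have P: "path P" using path_turn[of y z r w q] L q False by (simp add: P_def L_def)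
        have "P = rev L @ w # q" by (simp add: P_def L_def)
        then have "P ! 0 = rev L ! 0" "P ! 1 = rev L ! 1"
          using nth_append_prefix[of "rev L" "w # q"] by (simp_all add: L_def)
        moreover have "last P = v" using q by (simp add: P_def)
        ultimately have "v \<in> E \<longleftrightarrow> acc P"
          using mem_access[OF P] q(1) by (simp add: E_def P_def)
        also have "\<dots> \<longleftrightarrow> acc (rev L) \<and> fa y z w"
          using acc_glue[of "rev r" z y "w # q"] q by (simp add: P_def L_def)
        finally show ?thesis using acc_rev L by simp
      qed
      then have "access y w \<inter> E = (if acc L \<and> fa y z w then access y w else {})" by auto
      then show ?thesis using False by simp
    qed
  qed
  also have "\<dots> = of_bool (fa y x z) * card (common L) +
      (\<Sum>w | fa y x w. if acc L \<and> fa y z w then card (access y w) else 0)"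
    using finite_fa[OF y] by (simp add: sum.distrib)
  also have "(\<Sum>w | fa y x w. if acc L \<and> fa y z w then card (access y w) else 0) =
      of_bool (acc L) * (\<Sum>w | fa y x w \<and> fa y z w. card (access y w))"
    using finite_fa[OF y] sum.inter_filter[of "{w. fa y x w}" "\<lambda>w. card (access y w)" "fa y z"]
    by (simp add: conj_commute)
  finally show ?thesis by (simp add: L_def common_weight_def)
qed

text \<open>In the recursion, a failure of accessibility at \<open>y\<close> leaves at most the
  local term at \<open>y\<close>, which is even by assumption. Otherwise accessibility fails later,
  the local term vanishes, and induction applies to the rest.\<close>

lemma even_card_common:
  assumes "\<And>x a b. x \<in> nodes T \<Longrightarrow> (x, a) \<in> parcs T \<Longrightarrow> (x, b) \<in> parcs T \<Longrightarrow> a \<noteq> b \<Longrightarrow>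
      \<not> fa x a b \<Longrightarrow> even (common_weight x a b)"
  shows "path p \<Longrightarrow> 2 \<le> length p \<Longrightarrow> \<not> acc p \<Longrightarrow> even (card (common p))"
proof (induction p rule: induct_list012)
  case (3 x y r)
  then obtain z r' where r: "r = z # r'" by (cases r) auto
  have p: "path (x # y # z # r')" using 3 r by simp
  then have p': "path (y # z # r')" by (rule vpath_tl)
  have "y \<in> nodes T" using path_interior[OF p] .
  moreover have "(y, x) \<in> parcs T" "(y, z) \<in> parcs T" "x \<noteq> z"
    using p arcs_symmetric path_glue[of "[]" y z r'] by (auto simp: vpath_def)
  ultimately have "\<not> fa y x z \<Longrightarrow> even (common_weight y x z)" using assms by blast
  moreover have "fa y x z \<Longrightarrow> even (card (common (y # z # r'))) \<and> \<not> acc (y # z # r')"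
    using 3 r p' by auto
  ultimately have "even (int (card (common (x # y # z # r'))))"
    unfolding card_common_rec[OF p] by (cases "fa y x z") auto
  then show ?case using r by simp
qed auto

text \<open>Since accessibility fails at \<open>x\<close>, the local terms at all earlier vertices
  vanish, while the steps through these vertices are allowed. This isolates the local term at
  \<open>x\<close>.\<close>

lemma card_common_prefix:
  "path (p @ a # x # b # q) \<Longrightarrow> acc (p @ [a, x]) \<Longrightarrow> \<not> fa x a b \<Longrightarrow>
    card (common (p @ a # x # b # q)) = card (common (a # x # b # q))"
proof (induction p)
  case (Cons c p)
  obtain d e r where r: "p @ [a, x] = d # e # r" by (cases p; cases "tl p") auto
  then have eq: "p @ a # x # b # q = d # e # r @ b # q"
    by (metis append.assoc append_Cons append_Nil)
  have path: "path (c # d # e # r @ b # q)" using Cons.prems(1) eq by simp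
  have "acc (c # d # e # r)" using Cons.prems(2) r by simp
  then have "fa d c e" "acc (p @ [a, x])" using r by auto
  moreover have "\<not> acc (p @ a # x # b # q)" using acc_glue[of p a x "b # q"] Cons.prems(3) by simp
  ultimately have "card (common (c # p @ a # x # b # q)) = card (common (p @ a # x # b # q))"
    using card_common_rec[OF path] by (simp add: eq)
  moreover have "path (p @ a # x # b # q)" using vpath_tl[OF path] by (simp only: eq)
  ultimately show ?case using Cons.IH \<open>acc (p @ [a, x])\<close> Cons.prems(3) by simp
qed simp

section \<open>Condition (EN2)\<close>

lemma wEN2_iff:
  assumes "x \<in> nodes T"
  shows "wEN2 (F x) (weight T F \<rho> x) \<longleftrightarrow>
    (\<forall>a b. (x, a) \<in> parcs T \<and> (x, b) \<in> parcs T \<and> a \<noteq> b \<and> \<not> fa x a b \<longrightarrow> even (common_weight x a b))"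
    (is "?L \<longleftrightarrow> ?R")
proof -
  have inj: "inj_on (\<rho> x) (pverts (F x))" using bij[OF assms] by (simp add: bij_betw_def)
  show ?thesis
  proof
    assume L: ?L
    show ?R
    proof (intro allI impI)
      fix a b assume ab: "(x, a) \<in> parcs T \<and> (x, b) \<in> parcs T \<and> a \<noteq> b \<and> \<not> fa x a b"
      then obtain u v where u: "u \<in> pverts (F x)" "\<rho> x u = a" and v: "v \<in> pverts (F x)" "\<rho> x v = b"
        using rho_surj[OF assms] by metis
      have "u \<noteq> v" "(u, v) \<notin> parcs (F x)" using ab u v fa_iff[OF assms, of u v] by auto
      then have "even (wr_mat (F x) (weight T F \<rho> x) u v)"
        using L u v by (auto simp: wEN2_def cong_0_iff)
      then show "even (common_weight x a b)" using wr_mat_eq[OF assms, of u v] ab u v by simp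
    qed
  next
    assume R: ?R
    show ?L
      unfolding wEN2_def
    proof (intro ballI impI)
      fix u v assume u: "u \<in> pverts (F x)" and v: "v \<in> pverts (F x)"
        and uv: "u \<noteq> v \<and> (u, v) \<notin> parcs (F x)"
      then have "\<rho> x u \<noteq> \<rho> x v" "\<not> fa x (\<rho> x u) (\<rho> x v)"
        using inj fa_iff[OF assms u v] by (auto dest: inj_onD)
      then show "[wr_mat (F x) (weight T F \<rho> x) u v = 0] (mod 2)"
        using R rho_neighbour[OF assms] u v by (simp add: wr_mat_eq[OF assms u v] cong_0_iff)
    qed
  qed
qed

theorem EN2_iff:
  assumes "connected G"
  shows "EN2 G \<longleftrightarrow> (\<forall>x\<in>nodes T. wEN2 (F x) (weight T F \<rho> x))"
proof
  assume EN2: "EN2 G"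
  have "even (common_weight x a b)"
    if x: "x \<in> nodes T" and a: "(x, a) \<in> parcs T" and b: "(x, b) \<in> parcs T"
      and ab: "a \<noteq> b" "\<not> fa x a b" for x a b
  proof -
    obtain u where u: "u \<in> access x a" using access_nonempty[OF assms a] by blast
    then obtain p where p: "u \<in> leaves T" "path (x # a # p)" "last (x # a # p) = u" "acc (x # a # p)"
      unfolding access_def by blast
    obtain v where v: "v \<in> access x b" using access_nonempty[OF assms b] by blast
    then obtain q where q: "v \<in> leaves T" "path (x # b # q)" "last (x # b # q) = v" "acc (x # b # q)"
      unfolding access_def by blast
    \<comment> \<open>With accessible leaves chosen behind \<open>a\<close> and behind
      \<open>b\<close>, accessibility of the joined path fails at \<open>x\<close> alone, so the
      common neighbours of \<open>u\<close> and \<open>v\<close> are counted by the local term at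
      \<open>x\<close>.\<close>
    define P where "P = rev p @ a # x # b # q"
    have P: "path P" unfolding P_def using p q ab by (intro path_turn) auto
    have acc: "acc (rev p @ [a, x])" using acc_rev[OF p(2)] p(4) by simp
    have "\<not> acc P" using acc_glue[of "rev p" a x "b # q"] ab by (simp add: P_def)
    have hd: "hd P = u" using p(3) by (cases p rule: rev_cases) (auto simp: P_def)
    have last: "last P = v" using q(3) by (simp add: P_def)
    have "u \<noteq> v" using u v access_disjoint[OF ab(1)] by blast
    moreover have "(u, v) \<notin> parcs G"
      using adj_iff[OF P] hd last \<open>u \<noteq> v\<close> p(1) q(1) \<open>\<not> acc P\<close> by simp
    ultimately have "even (card (neighbours G u \<inter> neighbours G v))"
      using EN2 p(1) q(1) by (simp add: EN2_def)
    then have "even (card (common P))"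
      using common_eq_neighbours[OF P] hd last p(1) q(1) by (simp add: P_def)
    then have "even (int (card (common (a # x # b # q))))"
      using card_common_prefix[of "rev p" a x b q] P acc ab by (simp add: P_def)
    moreover have "path (a # x # b # q)" using q(2) a ab arcs_symmetric by simp
    then have "int (card (common (a # x # b # q))) = common_weight x a b"
      using card_common_rec[of a x b q] ab q(4) by simp
    ultimately show ?thesis by (simp only:)
  qed
  then show "\<forall>x\<in>nodes T. wEN2 (F x) (weight T F \<rho> x)" using wEN2_iff by blast
next
  assume "\<forall>x\<in>nodes T. wEN2 (F x) (weight T F \<rho> x)"
  then have even: "even (card (common p))" if "path p" "2 \<le> length p" "\<not> acc p" for p
    using that wEN2_iff by (intro even_card_common) blast+
  show "EN2 G"
    unfolding EN2_def
  proof (intro ballI impI)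
    fix u v assume u: "u \<in> pverts G" and v: "v \<in> pverts G" and uv: "u \<noteq> v \<and> (u, v) \<notin> parcs G"
    obtain p where p: "path p" "hd p = u" "last p = v"
      using path_exists[of u v] u v by (auto simp: leaves_def)
    have "2 \<le> length p" using p uv by (cases p; cases "tl p") (auto simp: vpath_def vwalk_def)
    moreover have "\<not> acc p" using adj_iff[OF p(1)] p u v uv by auto
    ultimately show "even (card (neighbours G u \<inter> neighbours G v))"
      using even[OF p(1)] common_eq_neighbours[OF p(1)] p u v by simp
  qed
qed

section \<open>Condition (RC)\<close>

lemma card_common_acc:
  "path p \<Longrightarrow> 2 \<le> length p \<Longrightarrow> acc p \<Longrightarrow>
    int (card (common p)) = sum_triples (\<lambda>x y z. common_weight y x z) p"
proof (induction p rule: induct_list012)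
  case (3 x y r)
  show ?case
  proof (cases r)
    case (Cons z r')
    have p: "path (x # y # z # r')" using 3 Cons by simp
    from card_common_rec[OF p] 3(2)[unfolded Cons, OF vpath_tl[OF p]] 3 Cons show ?thesis by simp
  qed simp
qed auto

lemma common_weight_sym: "common_weight x a b = common_weight x b a"
  by (simp add: common_weight_def conj_commute)

lemma r_mat_accessibility:
  assumes "path p" "hd p \<in> leaves T" "last p \<in> leaves T" "hd p \<noteq> last p" "acc p"
  shows "r_mat G (hd p) (last p) = 1 + sum_triples (\<lambda>x y z. common_weight y x z) p"
proof -
  have "2 \<le> length p" using assms by (cases p; cases "tl p") (auto simp: vpath_def vwalk_def)
  then show ?thesis
    using adj_iff[of p] assms common_eq_neighbours[of p] card_common_acc[of p]
    by (simp add: G.r_mat_eq)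
qed

text \<open>Potentials are moved from factor vertices to tree neighbours, where those of different
  factors can be combined. The 1 is the adjacency entry of \<open>wr_mat\<close>.\<close>

lemma wRC_iff:
  assumes x: "x \<in> nodes T"
  shows "wRC (F x) (weight T F \<rho> x) \<longleftrightarrow>
    (\<exists>g :: 'n \<Rightarrow> int. \<forall>a b. fa x a b \<longrightarrow> even (1 + common_weight x a b + g a + g b))"
proof -
  interpret F: pair_graph "F x" using factor x .
  have inj: "inj_on (\<rho> x) (pverts (F x))" using bij[OF x] by (simp add: bij_betw_def)
  have wr: "wr_mat (F x) (weight T F \<rho> x) u v = 1 + common_weight x (\<rho> x u) (\<rho> x v)"
    and fa: "fa x (\<rho> x u) (\<rho> x v)"
    and verts: "u \<in> pverts (F x)" "v \<in> pverts (F x)" if "(u, v) \<in> parcs (F x)" for u v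
    using that wr_mat_eq[OF x, of u v] fa_iff[OF x, of u v] by (auto simp: F.in_arcsD1 F.in_arcsD2)
  show ?thesis
    unfolding F.wRC_iff_potential
  proof
    assume "\<exists>\<phi> :: 'v \<Rightarrow> int. \<forall>(u, v)\<in>parcs (F x). even (wr_mat (F x) (weight T F \<rho> x) u v + \<phi> u + \<phi> v)"
    then obtain \<phi> :: "'v \<Rightarrow> int" where
      \<phi>: "\<forall>(u, v)\<in>parcs (F x). even (wr_mat (F x) (weight T F \<rho> x) u v + \<phi> u + \<phi> v)" by blast
    define g where "g a = \<phi> (inv_into (pverts (F x)) (\<rho> x) a)" for a
    have "even (1 + common_weight x a b + g a + g b)" if "fa x a b" for a b
    proof -
      from that obtain u v where uv: "(u, v) \<in> parcs (F x)" "\<rho> x u = a" "\<rho> x v = b"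
        by (auto simp: factor_adj_def)
      then have "g a = \<phi> u" "g b = \<phi> v" using verts[OF uv(1)] inj by (auto simp: g_def)
      moreover have "even (wr_mat (F x) (weight T F \<rho> x) u v + \<phi> u + \<phi> v)" using \<phi> uv(1) by blast
      ultimately show ?thesis unfolding wr[OF uv(1)] uv(2,3) by simp
    qed
    then show "\<exists>g :: 'n \<Rightarrow> int. \<forall>a b. fa x a b \<longrightarrow> even (1 + common_weight x a b + g a + g b)" by blast
  next
    assume "\<exists>g :: 'n \<Rightarrow> int. \<forall>a b. fa x a b \<longrightarrow> even (1 + common_weight x a b + g a + g b)"
    then obtain g :: "'n \<Rightarrow> int" where
      g: "\<And>a b. fa x a b \<Longrightarrow> even (1 + common_weight x a b + g a + g b)" by blast
    have "even (wr_mat (F x) (weight T F \<rho> x) u v + g (\<rho> x u) + g (\<rho> x v))"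
      if "(u, v) \<in> parcs (F x)" for u v
      using g[OF fa[OF that]] unfolding wr[OF that] .
    then show "\<exists>\<phi> :: 'v \<Rightarrow> int. \<forall>(u, v)\<in>parcs (F x). even (wr_mat (F x) (weight T F \<rho> x) u v + \<phi> u + \<phi> v)"
      by (intro exI[of _ "\<lambda>u. g (\<rho> x u)"]) blast
  qed
qed

theorem RC_iff:
  assumes "connected G"
  shows "RC G \<longleftrightarrow> (\<forall>x\<in>nodes T. wRC (F x) (weight T F \<rho> x))"
proof
  let ?s = "sum_triples (\<lambda>x y z. common_weight y x z)"
  assume "RC G"
  then obtain \<phi> :: "'n \<Rightarrow> int" where \<phi>: "\<forall>(u, v)\<in>parcs G. even (r_mat G u v + \<phi> u + \<phi> v)"
    unfolding G.RC_iff_potential by blast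
  show "\<forall>x\<in>nodes T. wRC (F x) (weight T F \<rho> x)"
  proof
    fix x assume x: "x \<in> nodes T"
    have "\<exists>q. path (x # a # q) \<and> last (x # a # q) \<in> leaves T \<and> acc (x # a # q)"
      if "(x, a) \<in> parcs T" for a
      using access_nonempty[OF assms that] unfolding access_def by blast
    then obtain Q where Q: "\<And>a. (x, a) \<in> parcs T \<Longrightarrow> path (x # a # Q a)"
      "\<And>a. (x, a) \<in> parcs T \<Longrightarrow> last (x # a # Q a) \<in> leaves T"
      "\<And>a. (x, a) \<in> parcs T \<Longrightarrow> acc (x # a # Q a)" by metis
    \<comment> \<open>The potential of \<open>G\<close> at the leaf chosen behind \<open>a\<close>,
      corrected by the local terms on the way there. For two neighbours \<open>a\<close> and
      \<open>b\<close> these corrections make up the sum over the joined path except for the term at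
      \<open>x\<close>.\<close>
    define g where "g a = \<phi> (last (x # a # Q a)) + ?s (x # a # Q a)" for a
    have "even (1 + common_weight x a b + g a + g b)" if fab: "fa x a b" for a b
    proof -
      note ab = fa_neighbours[OF x fab]
      define P where "P = rev (Q a) @ a # x # b # Q b"
      have P: "path P" unfolding P_def using Q(1)[OF ab(1)] Q(1)[OF ab(2)] ab(3) by (rule path_turn)
      have hd: "hd P = last (x # a # Q a)" by (cases "Q a" rule: rev_cases) (auto simp: P_def)
      have last: "last P = last (x # b # Q b)" by (simp add: P_def)
      have "acc (rev (x # a # Q a))" using acc_rev[OF Q(1)[OF ab(1)]] Q(3)[OF ab(1)] by simp
      then have acc: "acc P"
        using acc_glue[of "rev (Q a)" a x "b # Q b"] fab Q(3)[OF ab(2)] by (simp add: P_def)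
      have "last (x # a # Q a) \<in> branch x a" "last (x # b # Q b) \<in> branch x b"
        using Q ab by (auto intro!: mem_branch simp del: last.simps path_Cons3)
      then have "hd P \<noteq> last P" using branch_disjoint[OF ab(3), of x] unfolding hd last by force
      then have "r_mat G (hd P) (last P) = 1 + ?s P" "(hd P, last P) \<in> parcs G"
        using r_mat_accessibility[OF P] adj_iff[OF P] acc Q(2) ab hd last by auto
      moreover have "?s P = ?s (rev (x # a # Q a)) + ?s (a # x # b # Q b)"
        using sum_triples_glue[of _ "rev (Q a)" a x "b # Q b"] by (simp add: P_def)
      moreover have "?s (rev (x # a # Q a)) = ?s (x # a # Q a)"
        unfolding sum_triples_rev using common_weight_sym by metis
      ultimately have "r_mat G (hd P) (last P) + \<phi> (hd P) + \<phi> (last P) =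
          1 + common_weight x a b + g a + g b"
        unfolding g_def hd last by simp
      moreover have "even (r_mat G (hd P) (last P) + \<phi> (hd P) + \<phi> (last P))"
        using \<phi> \<open>(hd P, last P) \<in> parcs G\<close> by blast
      ultimately show ?thesis by simp
    qed
    then show "wRC (F x) (weight T F \<rho> x)" unfolding wRC_iff[OF x] by blast
  qed
next
  let ?s = "sum_triples (\<lambda>x y z. common_weight y x z)"
  assume "\<forall>x\<in>nodes T. wRC (F x) (weight T F \<rho> x)"
  then have "\<forall>x\<in>nodes T. \<exists>g :: 'n \<Rightarrow> int. \<forall>a b. fa x a b \<longrightarrow> even (1 + common_weight x a b + g a + g b)"
    using wRC_iff by blast
  then obtain h :: "'n \<Rightarrow> 'n \<Rightarrow> int" where
    h: "\<And>x a b. x \<in> nodes T \<Longrightarrow> fa x a b \<Longrightarrow> even (1 + common_weight x a b + h x a + h x b)"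
    by metis
  \<comment> \<open>The value 0 at leaves makes the two boundary terms in \<open>walk\<close> vanish
    for a path between leaves.\<close>
  define g where "g x a = (if x \<in> nodes T then h x a else 0)" for x a
  \<comment> \<open>Each tree edge collects the factor potentials at its two ends. A path has one
    more edge than inner vertices, so the 1 of every edge and the 1 of every local relation leave a
    single 1 modulo 2, the adjacency entry of \<open>r_mat\<close>.\<close>
  define k where "k x y = g x y + g y x + 1" for x y
  \<comment> \<open>A potential for \<open>k\<close> on the whole tree; its restriction to the
    leaves will be the potential on \<open>G\<close>.\<close>
  obtain \<psi> :: "'n \<Rightarrow> int" where \<psi>: "\<forall>(x, y)\<in>parcs T. even (k x y + \<psi> x + \<psi> y)"
    using tree_potential[of k] by (auto simp: k_def)
  \<comment> \<open>The local relations are added up along the path: the factor potentials at inner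
    vertices cancel against those in \<open>k\<close>, and only those at the two end edges
    remain.\<close>
  have walk: "even (walk_sum k p + 1 + ?s p + g (p ! 0) (p ! 1) + g (rev p ! 0) (rev p ! 1))"
    if "path p" "2 \<le> length p" "acc p" for p
    using that
  proof (induction p rule: induct_list012)
    case (3 x y r)
    show ?case
    proof (cases r)
      case Nil
      then show ?thesis by (simp add: walk_sum_def k_def)
    next
      case (Cons z r')
      have p: "path (x # y # z # r')" using 3 Cons by simp
      define E where "E = g (rev (y # r) ! 0) (rev (y # r) ! 1)"
      have E: "g (rev (x # y # r) ! 0) (rev (x # y # r) ! 1) = E"
        using nth_append_prefix[of "rev (y # r)" "[x]"] by (simp add: E_def Cons)
      have "even (walk_sum k (y # r) + 1 + ?s (y # r) + g y z + E)"
        using 3(2) 3(5) vpath_tl[OF p] by (simp add: Cons E_def)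
      moreover have "even (1 + common_weight y x z + g y x + g y z)"
        using h path_interior[OF p] 3(5) by (simp add: g_def Cons)
      ultimately have "even ((walk_sum k (y # r) + 1 + ?s (y # r) + g y z + E) +
          (1 + common_weight y x z + g y x + g y z) + 2 * g x y)"
        by (metis dvd_add dvd_triv_left)
      moreover have "walk_sum k (x # y # r) + 1 + ?s (x # y # r) + g x y + E + 2 * g y z =
          (walk_sum k (y # r) + 1 + ?s (y # r) + g y z + E) +
          (1 + common_weight y x z + g y x + g y z) + 2 * g x y"
        by (simp add: walk_sum_def k_def Cons)
      ultimately have "even (walk_sum k (x # y # r) + 1 + ?s (x # y # r) + g x y + E)"
        by (metis dvd_add_left_iff dvd_triv_left)
      moreover have "(x # y # r) ! 1 = y" by simp
      ultimately show ?thesis by (simp only: E nth_Cons_0)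
    qed
  qed auto
  have "even (r_mat G u v + \<psi> u + \<psi> v)" if "(u, v) \<in> parcs G" for u v
  proof -
    from that obtain p where p: "path p" "hd p = u" "last p = v" "acc p"
      "u \<in> leaves T" "v \<in> leaves T" "u \<noteq> v" by (rule adjE)
    have len: "2 \<le> length p" using p by (cases p; cases "tl p") (auto simp: vpath_def vwalk_def)
    then have "p \<noteq> []" by auto
    then have "p ! 0 = u" "rev p ! 0 = v"
      using p hd_conv_nth[of p] hd_conv_nth[of "rev p"] by (simp_all add: hd_rev)
    moreover have "u \<notin> nodes T" "v \<notin> nodes T" using p(5,6) node_not_leaf by blast+
    ultimately have "even (walk_sum k p + (1 + ?s p))"
      using walk[OF p(1) len p(4)] by (auto simp: g_def)
    moreover have "r_mat G u v = 1 + ?s p" using r_mat_accessibility[OF p(1)] p by simp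
    moreover have "even (walk_sum k p + \<psi> u + \<psi> v)"
      using even_walk_sum_potential[OF \<psi>, of p] p by (simp add: vpath_def)
    ultimately show ?thesis by presburger
  qed
  then show "RC G" unfolding G.RC_iff_potential by blast
qed

end

theorem proposition4p9:
  fixes T :: "'n pair_pre_digraph"
    and F :: "'n \<Rightarrow> 'v pair_pre_digraph"
    and \<rho> :: "'n \<Rightarrow> 'v \<Rightarrow> 'n"
    and G :: "'n pair_pre_digraph"
  assumes "graph_labelled_tree T F \<rho>"
    and "G = accessibility_graph T F \<rho>"
    and "connected (with_proj G)"
  shows "(nodes T \<noteq> {} \<longrightarrow> (EN1 G \<longleftrightarrow> (\<forall>x\<in>nodes T. wEN1 (F x) (weight T F \<rho> x)))) \<and>
    (EN2 G \<longleftrightarrow> (\<forall>x\<in>nodes T. wEN2 (F x) (weight T F \<rho> x))) \<and>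
    (RC G \<longleftrightarrow> (\<forall>x\<in>nodes T. wRC (F x) (weight T F \<rho> x))) \<and>
    ((\<forall>v\<in>pverts G. even (degree G v)) \<longrightarrow>
      (Gaussian G \<longleftrightarrow> (\<forall>x\<in>nodes T. CL2 (F x) (weight T F \<rho> x))))"
proof -
  interpret graph_labelled_tree T F \<rho> by fact
  note conn = assms(3)[unfolded assms(2)]
  show ?thesis
    using EN1_iff EN2_iff[OF conn] RC_iff[OF conn]
    unfolding assms(2) Gaussian_def CL2_def EN1_def by blast
qed

end
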